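(* Let $\beta$ be an ordinal with $\omega\le\beta<\omega^\omega$. Then $\beta$ satisfies a monadic second order Cesàro limit law: for every monadic second order sentence $\varphi$ in the language of linear orders, the limit $$\lim_{n\to\infty}\frac1n\sum_{i=0}^n\delta_\varphi^\beta(i)$$ exists, where $\delta_\varphi^\beta(n)=\dfrac{\#\{\alpha<\beta:\ \alpha\models\varphi,\ N(\alpha)=n\}}{\#\{\alpha<\beta:\ N(\alpha)=n\}}$. Moreover this limit is always a rational number.
   Context: Let $\varepsilon_0$ be the least ordinal $\xi$ with $\xi=\omega^\xi$. Every $\alpha<\varepsilon_0$ has a unique Cantor normal form $\alpha=\omega^{\alpha_1}+\cdots+\omega^{\alpha_n}$ with $\alpha_1\ge\cdots\ge\alpha_n$ (with $n=0$ for $\alpha=0$). The norm $N:\varepsilon_0\to\mathbb N$ is defined recursively by $N(0)=0$ and $N(\alpha)=n+N(\alpha_1)+\cdots+N(\alpha_n)$ (so $N(\omega^i)=i+1$ for $i<\omega$). For each infinite $\beta\le\varepsilon_0$ and each $n$, the set $\{\alpha<\beta:N(\alpha)=n\}$ is finite and non-empty. The monadic second order language of linear orders has a single relation symbol $<$ (no constants, no function symbols); $\alpha\models\varphi$ means that the structure $\langle\alpha,<\rangle$, where $\alpha$ is identified with the set of smaller ordinals, satisfies $\varphi$, set variables ranging over all subsets of $\alpha$. *)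

theory Defs
  imports Complex_Main "HOL-Library.Multiset"
begin

section \<open>The ordinals below \<open>\<epsilon>\<^sub>0\<close>\<close>

text \<open>
  An ordinal below \<open>\<epsilon>\<^sub>0\<close> is represented by its (hereditary) Cantor normal form:
  \<open>CNF [\<alpha>\<^sub>1, \<dots>, \<alpha>\<^sub>n]\<close> stands for \<open>\<omega>\<^bsup>\<alpha>\<^sub>1\<^esup> + \<dots> + \<omega>\<^bsup>\<alpha>\<^sub>n\<^esup>\<close>. On normal forms the ordering of the
  ordinals is the lexicographic ordering of the lists of exponents.
\<close>

datatype cnf = CNF "cnf list"

fun cnf_less :: "cnf \<Rightarrow> cnf \<Rightarrow> bool" where
  "cnf_less (CNF []) (CNF bs) \<longleftrightarrow> bs \<noteq> []"
| "cnf_less (CNF (a # as)) (CNF []) \<longleftrightarrow> False"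
| "cnf_less (CNF (a # as)) (CNF (b # bs)) \<longleftrightarrow>
     cnf_less a b \<or> a = b \<and> cnf_less (CNF as) (CNF bs)"

lemma cnf_less_irrefl: "\<not> cnf_less x x"
proof -
  have "x = y \<Longrightarrow> \<not> cnf_less x y" for y
    by (induction x y rule: cnf_less.induct) auto
  then show ?thesis by blast
qed

lemma cnf_less_trans: "cnf_less x y \<Longrightarrow> cnf_less y z \<Longrightarrow> cnf_less x z"
proof (induction x y arbitrary: z rule: cnf_less.induct)
  case (1 bs)
  then show ?case by (cases z, cases bs, simp, case_tac x, auto)
next
  case (2 a as)
  then show ?case by simp
next
  case (3 a as b bs)
  obtain cs where z: "z = CNF cs" by (cases z)
  then show ?case using 3 by (cases cs) auto
qed

lemma cnf_less_linear: "cnf_less x y \<or> x = y \<or> cnf_less y x"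
proof (induction x y rule: cnf_less.induct)
  case (1 bs)
  then show ?case by (cases bs) auto
qed auto

instantiation cnf :: linorder
begin

definition less_cnf :: "cnf \<Rightarrow> cnf \<Rightarrow> bool" where
  "less_cnf = cnf_less"

definition less_eq_cnf :: "cnf \<Rightarrow> cnf \<Rightarrow> bool" where
  "less_eq_cnf x y \<longleftrightarrow> x = y \<or> cnf_less x y"

instance
proof
  fix x y z :: cnf
  show "x < y \<longleftrightarrow> x \<le> y \<and> \<not> y \<le> x"
    using cnf_less_irrefl cnf_less_trans unfolding less_cnf_def less_eq_cnf_def by blast
  show "x \<le> x" by (simp add: less_eq_cnf_def)
  show "x \<le> y \<Longrightarrow> y \<le> z \<Longrightarrow> x \<le> z"
    using cnf_less_trans unfolding less_eq_cnf_def by blast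
  show "x \<le> y \<Longrightarrow> y \<le> x \<Longrightarrow> x = y"
    using cnf_less_irrefl cnf_less_trans unfolding less_eq_cnf_def by blast
  show "x \<le> y \<or> y \<le> x"
    using cnf_less_linear unfolding less_eq_cnf_def by blast
qed

end

lemma cnf_less_simps [simp]:
  "CNF [] < CNF bs \<longleftrightarrow> bs \<noteq> []"
  "\<not> x < CNF []"
  "CNF (a # as) < CNF (b # bs) \<longleftrightarrow> a < b \<or> a = b \<and> CNF as < CNF bs"
  "CNF [] \<le> x"
  unfolding less_cnf_def less_eq_cnf_def
  by simp_all (metis cnf.exhaust cnf_less.simps(1,2) list.exhaust, metis cnf.exhaust cnf_less.simps(1))

fun normal :: "cnf \<Rightarrow> bool" where
  "normal (CNF as) \<longleftrightarrow> sorted_wrt (\<ge>) as \<and> (\<forall>a \<in> set as. normal a)"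

fun cnf_norm :: "cnf \<Rightarrow> nat" where
  "cnf_norm (CNF as) = length as + sum_list (map cnf_norm as)"

typedef eps0 = "{x. normal x}"
  by (rule exI[of _ "CNF []"]) simp

setup_lifting type_definition_eps0

instantiation eps0 :: linorder
begin

lift_definition less_eps0 :: "eps0 \<Rightarrow> eps0 \<Rightarrow> bool" is "(<)" .
lift_definition less_eq_eps0 :: "eps0 \<Rightarrow> eps0 \<Rightarrow> bool" is "(\<le>)" .

instance by standard (transfer; force)+

end

lemma CNF_prefix:
  assumes "CNF xs < CNF ys"
  obtains (prefix) z zs where "ys = xs @ z # zs"
  | (diff) p a s b t where "xs = p @ a # s" "ys = p @ b # t" "a < b"
  using assms
proof (induction xs arbitrary: ys thesis)
  case Nil
  then show ?case by (cases ys) auto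
next
  case (Cons x xs)
  show ?case
  proof (cases ys)
    case Nil
    then show ?thesis using Cons.prems by simp
  next
    case [simp]: (Cons y ys')
    consider "x < y" | "x = y" "CNF xs < CNF ys'" using Cons.prems by auto
    then show ?thesis
    proof cases
      case 1
      then show ?thesis using Cons.prems(2)[of "[]" x xs y ys'] by simp
    next
      case 2
      show ?thesis
      proof (rule Cons.IH[of ys'])
        show "thesis" if "ys' = xs @ z # zs" for z zs
          using Cons.prems(1)[of z zs] that 2 by simp
        show "thesis" if "xs = p @ a # s" "ys' = p @ b # t" "a < b" for p a s b t
          using Cons.prems(2)[of "x # p" a s b t] that 2 by simp
      qed (use 2 in simp)
    qed
  qed
qed

lemma normal_tail_le: "normal (CNF (p @ a # s)) \<Longrightarrow> x \<in> set s \<Longrightarrow> x \<le> a"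
  by (auto simp: sorted_wrt_append)

lemma wf_normal: "wf {(x, y). normal x \<and> normal y \<and> x < y}" (is "wf ?R")
proof -
  let ?A = "Wellfounded.acc ?R"
  let ?S = "{(x, y). x < y \<and> x \<in> ?A \<and> y \<in> ?A \<and> normal x \<and> normal y}"
  have down: "x \<in> ?A" if "y \<in> ?A" "x \<le> y" "normal x" "normal y" for x y
    using that acc_downward[of y ?R x] by (cases "x = y") auto
  have wfS: "wf ?S"
  proof -
    have "wf ({(x, y). (x, y) \<in> ?R \<and> y \<in> ?A})"
      unfolding wf_def
    proof (intro allI impI)
      fix P x assume *: "\<forall>x. (\<forall>y. (y, x) \<in> {(x, y). (x, y) \<in> ?R \<and> y \<in> ?A} \<longrightarrow> P y) \<longrightarrow> P x"
      show "P x"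
      proof (cases "x \<in> ?A")
        case True
        then show ?thesis
        proof (rule acc_induct[of x ?R P])
          fix z assume "z \<in> ?A" and "\<forall>y. (y, z) \<in> ?R \<longrightarrow> P y"
          then have "\<forall>y. (y, z) \<in> {(x, y). (x, y) \<in> ?R \<and> y \<in> ?A} \<longrightarrow> P y" by simp
          then show "P z" using *[THEN spec, of z] by (rule rev_mp)
        qed
      next
        case False
        then show ?thesis using * by blast
      qed
    qed
    then show ?thesis by (rule wf_subset) auto
  qed
  have step: "CNF ys \<in> ?A" if "normal (CNF ys)" "set ys \<subseteq> ?A" for ys
    using wf_mult[OF wfS] that
  proof (induction "mset ys" arbitrary: ys rule: wf_induct_rule)
    case less
    show ?case
    proof (rule accI)
      fix y assume "(y, CNF ys) \<in> ?R"
      then have y: "normal y" "y < CNF ys" by auto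
      obtain xs where [simp]: "y = CNF xs" by (cases y)
      have "CNF xs < CNF ys" using y by simp
      then show "y \<in> ?A"
      proof (cases rule: CNF_prefix)
        case (prefix z zs)
        have "(mset xs + {#}, mset xs + mset (z # zs)) \<in> mult ?S"
          by (rule one_step_implies_mult) auto
        then have "(mset xs, mset ys) \<in> mult ?S" by (simp add: prefix)
        then show ?thesis using less.hyps[of xs] y less.prems prefix by auto
      next
        case (diff p a s b t)
        have nb: "normal b" "b \<in> ?A" using less.prems diff by auto
        have as: "normal x \<and> x < b" if "x \<in> set (a # s)" for x
          using y that diff normal_tail_le[of p a s x] by auto
        have asA: "x \<in> ?A" if "x \<in> set (a # s)" for x
          using as[OF that] nb down[of b x] by auto
        have "(mset p + mset (a # s), mset p + mset (b # t)) \<in> mult ?S"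
        proof (rule one_step_implies_mult)
          show "\<forall>k\<in>#mset (a # s). \<exists>j\<in>#mset (b # t). (k, j) \<in> ?S"
            using as asA nb by auto
        qed auto
        then have "(mset xs, mset ys) \<in> mult ?S" by (simp add: diff)
        moreover have "set xs \<subseteq> ?A" using less.prems diff asA by auto
        ultimately show ?thesis using less.hyps[of xs] y by auto
      qed
    qed
  qed
  have acc: "x \<in> ?A" for x
  proof (induction x)
    case (CNF ys)
    show ?case
    proof (cases "normal (CNF ys)")
      case True
      then show ?thesis using step[of ys] CNF by blast
    next
      case False
      then show ?thesis by - (rule accI, auto)
    qed
  qed
  then show ?thesis by (simp add: acc_wfI)
qed

instance eps0 :: wellorder
proof
  fix P :: "eps0 \<Rightarrow> bool" and a
  assume step: "\<And>x. (\<And>y. y < x \<Longrightarrow> P y) \<Longrightarrow> P x"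
  have "wf {(x, y :: eps0). x < y}"
    by (rule wf_subset[OF wf_inv_image[OF wf_normal, of Rep_eps0]])
      (use Rep_eps0 in \<open>auto simp: inv_image_def less_eps0.rep_eq\<close>)
  then show "P a" by (induction a) (use step in auto)
qed

fun cnf_plus :: "cnf \<Rightarrow> cnf \<Rightarrow> cnf" where
  "cnf_plus (CNF as) (CNF []) = CNF as"
| "cnf_plus (CNF as) (CNF (b # bs)) = CNF (takeWhile (\<lambda>a. b \<le> a) as @ b # bs)"

lemma normal_cnf_plus: "normal x \<Longrightarrow> normal y \<Longrightarrow> normal (cnf_plus x y)"
proof (induction x y rule: cnf_plus.induct)
  case (2 as b bs)
  have "sorted_wrt (\<ge>) (takeWhile (\<lambda>a. b \<le> a) as)"
    using 2 by (metis normal.simps sorted_wrt_append takeWhile_dropWhile_id)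
  then show ?case using 2 by (auto simp: sorted_wrt_append dest!: set_takeWhileD)
qed simp

instantiation eps0 :: "{zero, plus}"
begin

lift_definition zero_eps0 :: eps0 is "CNF []" by simp
lift_definition plus_eps0 :: "eps0 \<Rightarrow> eps0 \<Rightarrow> eps0" is cnf_plus
  by (rule normal_cnf_plus)

instance ..

end

lift_definition omega_pow :: "eps0 \<Rightarrow> eps0" is "\<lambda>x. CNF [x]" by simp

definition omega :: eps0 where
  "omega = omega_pow (omega_pow 0)"

lift_definition ord_norm :: "eps0 \<Rightarrow> nat" is cnf_norm .

text \<open>
  Adequacy of the representation. The order type of \<open>\<alpha> + \<beta>\<close> is that of a copy of \<open>\<alpha>\<close> followed
  by a copy of \<open>\<beta>\<close>, and \<open>\<omega>\<^bsup>\<beta>\<^esup>\<close> is the least ordinal above all \<open>\<omega>\<^bsup>\<alpha>\<^esup> \<cdot> n\<close> with \<open>\<alpha> < \<beta>\<close> (for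
  \<open>\<beta> \<noteq> 0\<close>; it is \<open>1\<close> for \<open>\<beta> = 0\<close>). Together with well-foundedness these determine the
  operations, and as \<open>\<xi> < \<omega>\<^bsup>\<xi>\<^esup>\<close> for all \<open>\<xi>\<close>, the order type of \<^typ>\<open>eps0\<close> is \<open>\<epsilon>\<^sub>0\<close>.
\<close>

lemma CNF_append_less [simp]: "CNF (p @ xs) < CNF (p @ ys) \<longleftrightarrow> CNF xs < CNF ys"
  by (induction p) auto

lemma cnf_plus_mono:
  assumes "y < z"
  shows "cnf_plus x y < cnf_plus x z"
proof -
  obtain as ys zs where xyz [simp]: "x = CNF as" "y = CNF ys" "z = CNF zs"
    by (metis cnf.exhaust)
  obtain c cs where zs [simp]: "zs = c # cs" using assms by (cases zs) auto
  define p where "p = takeWhile (\<lambda>a. c \<le> a) as"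
  define r where "r = dropWhile (\<lambda>a. c \<le> a) as"
  have as: "as = p @ r" by (simp add: p_def r_def)
  have r: "hd r < c" if "r \<noteq> []"
    using hd_dropWhile[of "\<lambda>a. c \<le> a" as] that by (simp add: r_def)
  have p: "\<forall>a \<in> set p. c \<le> a" by (auto simp: p_def dest: set_takeWhileD)
  have z: "cnf_plus x z = CNF (p @ c # cs)" by (simp add: p_def)
  show ?thesis
  proof (cases ys)
    case Nil
    have "CNF r < CNF (c # cs)" using r by (cases r) auto
    then show ?thesis unfolding z using Nil by (simp add: as)
  next
    case (Cons b bs)
    then consider "b < c" | "b = c" "CNF bs < CNF cs" using assms by auto
    then show ?thesis
    proof cases
      case 1
      define q where "q = takeWhile (\<lambda>a. b \<le> a) r"
      have "cnf_plus x y = CNF (p @ q @ b # bs)"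
      proof -
        have "\<forall>a \<in> set p. b \<le> a" using p 1 by auto
        then show ?thesis using Cons by (simp add: as q_def takeWhile_append)
      qed
      moreover have "CNF (q @ b # bs) < CNF (c # cs)"
        using r 1 by (cases r) (auto simp: q_def)
      ultimately show ?thesis unfolding z by simp
    next
      case 2
      then show ?thesis using Cons by simp
    qed
  qed
qed

lemma cnf_plus_diff:
  assumes "normal x" "normal y" "x \<le> y"
  shows "\<exists>z. normal z \<and> y = cnf_plus x z"
proof (cases "x = y")
  case True
  have "cnf_plus x (CNF []) = x" by (cases x) simp
  then show ?thesis using True by (intro exI[of _ "CNF []"]) simp
next
  case False
  obtain xs ys where [simp]: "x = CNF xs" "y = CNF ys" by (metis cnf.exhaust)
  have "CNF xs < CNF ys" using False assms by (auto simp: order.strict_iff_order)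
  then show ?thesis
  proof (cases rule: CNF_prefix)
    case (prefix z zs)
    have tw: "takeWhile (\<lambda>a. z \<le> a) xs = xs"
      using assms prefix by (auto simp: takeWhile_eq_all_conv sorted_wrt_append)
    have "CNF ys = cnf_plus (CNF xs) (CNF (z # zs))"
      by (simp only: cnf_plus.simps tw prefix)
    then show ?thesis using assms prefix
      by (intro exI[of _ "CNF (z # zs)"]) (auto simp: sorted_wrt_append)
  next
    case (diff p a s b t)
    have "takeWhile (\<lambda>a. b \<le> a) xs = p"
    proof -
      have "\<forall>c \<in> set p. b \<le> c" using assms diff by (auto simp: sorted_wrt_append)
      then show ?thesis using diff by (simp add: takeWhile_append)
    qed
    then show ?thesis using assms diff
      by (intro exI[of _ "CNF (b # t)"]) (auto simp: sorted_wrt_append)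
  qed
qed

lemma plus_strict_mono:
  fixes \<alpha> \<beta> \<gamma> :: eps0
  shows "\<beta> < \<gamma> \<Longrightarrow> \<alpha> + \<beta> < \<alpha> + \<gamma>"
  by transfer (rule cnf_plus_mono)

lemma eps0_plus_zero: "\<alpha> + 0 = (\<alpha> :: eps0)"
proof transfer
  fix x show "cnf_plus x (CNF []) = x" by (cases x) simp
qed

lemma eps0_zero_plus: "0 + \<alpha> = (\<alpha> :: eps0)"
proof transfer
  fix x show "cnf_plus (CNF []) x = x"
    by (cases x, rename_tac as, case_tac as) auto
qed

lemma eps0_zero_le: "0 \<le> (\<alpha> :: eps0)"
  by transfer simp

lemma eps0_diff:
  fixes \<alpha> \<beta> :: eps0
  shows "\<alpha> \<le> \<beta> \<Longrightarrow> \<exists>\<gamma>. \<beta> = \<alpha> + \<gamma>"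
  by transfer (use cnf_plus_diff in blast)

lemma less_plus_iff:
  fixes \<alpha> \<beta> \<xi> :: eps0
  shows "\<xi> < \<alpha> + \<beta> \<longleftrightarrow> \<xi> < \<alpha> \<or> (\<exists>\<eta> < \<beta>. \<xi> = \<alpha> + \<eta>)"
proof
  assume *: "\<xi> < \<alpha> + \<beta>"
  show "\<xi> < \<alpha> \<or> (\<exists>\<eta> < \<beta>. \<xi> = \<alpha> + \<eta>)"
  proof (cases "\<xi> < \<alpha>")
    case False
    then have "\<alpha> \<le> \<xi>" by simp
    then obtain \<eta> where \<eta>: "\<xi> = \<alpha> + \<eta>" using eps0_diff by blast
    have "\<eta> < \<beta>"
      using * \<eta> plus_strict_mono[of \<beta> \<eta> \<alpha>] by (cases \<eta> \<beta> rule: linorder_cases) auto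
    then show ?thesis using \<eta> by blast
  qed blast
next
  have "\<alpha> \<le> \<alpha> + \<beta>"
  proof (cases "\<beta> = 0")
    case False
    then have "0 < \<beta>" using eps0_zero_le[of \<beta>] by (auto simp: order.strict_iff_order)
    then show ?thesis
      using plus_strict_mono[of 0 \<beta> \<alpha>] by (simp add: eps0_plus_zero less_imp_le)
  qed (simp add: eps0_plus_zero)
  then show "\<xi> < \<alpha> + \<beta>" if "\<xi> < \<alpha> \<or> (\<exists>\<eta> < \<beta>. \<xi> = \<alpha> + \<eta>)"
    using that plus_strict_mono by auto
qed

instance eps0 :: monoid_add
proof
  fix \<alpha> \<beta> \<gamma> :: eps0
  show "\<alpha> + \<beta> + \<gamma> = \<alpha> + (\<beta> + \<gamma>)"
  proof (induction \<gamma> rule: less_induct)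
    case (less \<gamma>)
    have "\<xi> < \<alpha> + \<beta> + \<gamma> \<longleftrightarrow> \<xi> < \<alpha> + (\<beta> + \<gamma>)" for \<xi>
    proof -
      have "\<xi> < \<alpha> + \<beta> + \<gamma> \<longleftrightarrow>
          \<xi> < \<alpha> \<or> (\<exists>\<eta> < \<beta>. \<xi> = \<alpha> + \<eta>) \<or> (\<exists>\<zeta> < \<gamma>. \<xi> = \<alpha> + (\<beta> + \<zeta>))"
        unfolding less_plus_iff[of \<xi> "\<alpha> + \<beta>"] less_plus_iff[of \<xi> \<alpha> \<beta>]
        by (simp add: less cong: conj_cong)
      moreover have "\<xi> < \<alpha> + (\<beta> + \<gamma>) \<longleftrightarrow>
          \<xi> < \<alpha> \<or> (\<exists>\<eta> < \<beta>. \<xi> = \<alpha> + \<eta>) \<or> (\<exists>\<zeta> < \<gamma>. \<xi> = \<alpha> + (\<beta> + \<zeta>))"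
        unfolding less_plus_iff[of \<xi> \<alpha> "\<beta> + \<gamma>"] less_plus_iff[of _ \<beta> \<gamma>] by blast
      ultimately show ?thesis by (rule trans[OF _ sym])
    qed
    then show ?case by (cases "\<alpha> + \<beta> + \<gamma>" "\<alpha> + (\<beta> + \<gamma>)" rule: linorder_cases) auto
  qed
qed (rule eps0_zero_plus eps0_plus_zero)+

lemma Rep_cantor_sum:
  "sorted_wrt (\<ge>) \<alpha>s \<Longrightarrow> Rep_eps0 (\<Sum>\<alpha>\<^sub>i\<leftarrow>\<alpha>s. omega_pow \<alpha>\<^sub>i) = CNF (map Rep_eps0 \<alpha>s)"
proof (induction \<alpha>s)
  case Nil
  then show ?case by (simp add: zero_eps0.rep_eq)
next
  case (Cons \<alpha> \<alpha>s)
  then show ?case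
    by (cases \<alpha>s) (auto simp: plus_eps0.rep_eq omega_pow.rep_eq zero_eps0.rep_eq less_eq_eps0.rep_eq)
qed

lemma ex1_cantor_normal_form:
  "\<exists>!\<alpha>s. sorted_wrt (\<ge>) \<alpha>s \<and> \<alpha> = (\<Sum>\<alpha>\<^sub>i\<leftarrow>\<alpha>s. omega_pow \<alpha>\<^sub>i)"
proof (rule ex_ex1I)
  obtain as where as: "Rep_eps0 \<alpha> = CNF as" by (cases "Rep_eps0 \<alpha>")
  then have n: "normal (CNF as)" using Rep_eps0[of \<alpha>] by simp
  define \<alpha>s where "\<alpha>s = map Abs_eps0 as"
  have m: "map Rep_eps0 \<alpha>s = as"
    using n by (auto simp: \<alpha>s_def Abs_eps0_inverse intro!: map_idI)
  have s: "sorted_wrt (\<ge>) \<alpha>s"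
    using n by (subst (asm) m[symmetric]) (simp add: sorted_wrt_map less_eq_eps0.rep_eq)
  have "\<alpha> = (\<Sum>\<alpha>\<^sub>i\<leftarrow>\<alpha>s. omega_pow \<alpha>\<^sub>i)"
    using Rep_cantor_sum[OF s] as m by (simp add: Rep_eps0_inject[symmetric])
  then show "\<exists>\<alpha>s. sorted_wrt (\<ge>) \<alpha>s \<and> \<alpha> = (\<Sum>\<alpha>\<^sub>i\<leftarrow>\<alpha>s. omega_pow \<alpha>\<^sub>i)" using s by blast
next
  fix \<alpha>s \<beta>s
  assume "sorted_wrt (\<ge>) \<alpha>s \<and> \<alpha> = (\<Sum>\<alpha>\<^sub>i\<leftarrow>\<alpha>s. omega_pow \<alpha>\<^sub>i)"
    and "sorted_wrt (\<ge>) \<beta>s \<and> \<alpha> = (\<Sum>\<alpha>\<^sub>i\<leftarrow>\<beta>s. omega_pow \<alpha>\<^sub>i)"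
  then have "map Rep_eps0 \<alpha>s = map Rep_eps0 \<beta>s" by (metis Rep_cantor_sum cnf.inject)
  then show "\<alpha>s = \<beta>s" by (simp add: inj_on_def Rep_eps0_inject inj_map_eq_map)
qed

lemma ord_norm_cantor_normal_form:
  "sorted_wrt (\<ge>) \<alpha>s \<Longrightarrow>
    ord_norm (\<Sum>\<alpha>\<^sub>i\<leftarrow>\<alpha>s. omega_pow \<alpha>\<^sub>i) = length \<alpha>s + (\<Sum>\<alpha>\<^sub>i\<leftarrow>\<alpha>s. ord_norm \<alpha>\<^sub>i)"
  by (simp add: ord_norm.rep_eq Rep_cantor_sum o_def ord_norm.rep_eq[abs_def])

lemma Rep_omega_pow_mult:
  "Rep_eps0 (sum_list (replicate n (omega_pow \<alpha>))) = CNF (replicate n (Rep_eps0 \<alpha>))"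
  using Rep_cantor_sum[of "replicate n \<alpha>"] by (simp add: sorted_wrt_iff_nth_less)

lemma less_CNF_replicate: "\<forall>x \<in> set xs. x \<le> a \<Longrightarrow> CNF xs < CNF (replicate (Suc (length xs)) a)"
proof (induction xs)
  case (Cons x xs)
  then have "CNF xs < CNF (replicate (Suc (length xs)) a)" "x \<le> a" by auto
  then show ?case by (cases "x = a") auto
qed simp

lemma less_omega_pow_iff:
  "\<xi> < omega_pow \<beta> \<longleftrightarrow> \<xi> = 0 \<or> (\<exists>\<alpha> < \<beta>. \<exists>n. \<xi> < sum_list (replicate n (omega_pow \<alpha>)))"
proof -
  obtain xs where xs: "Rep_eps0 \<xi> = CNF xs" by (cases "Rep_eps0 \<xi>")
  then have n: "normal (CNF xs)" using Rep_eps0[of \<xi>] by simp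
  show ?thesis
  proof (cases xs)
    case Nil
    then have "\<xi> = 0" using xs by (simp add: Rep_eps0_inject[symmetric] zero_eps0.rep_eq)
    then show ?thesis by (simp add: less_eps0.rep_eq zero_eps0.rep_eq omega_pow.rep_eq)
  next
    case [simp]: (Cons x xs')
    have "\<xi> \<noteq> 0" using xs by (auto simp: zero_eps0.rep_eq)
    have "x < Rep_eps0 \<beta> \<longleftrightarrow>
        (\<exists>\<alpha> < \<beta>. \<exists>n. CNF xs < CNF (replicate n (Rep_eps0 \<alpha>)))"
    proof
      assume x: "x < Rep_eps0 \<beta>"
      have "Rep_eps0 (Abs_eps0 x) = x" using n by (simp add: Abs_eps0_inverse)
      moreover have "CNF xs < CNF (replicate (Suc (length xs)) x)"
        by (rule less_CNF_replicate) (use n in auto)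
      ultimately show "\<exists>\<alpha> < \<beta>. \<exists>n. CNF xs < CNF (replicate n (Rep_eps0 \<alpha>))"
        using x by (intro exI[of _ "Abs_eps0 x"] conjI exI[of _ "Suc (length xs)"])
          (simp_all only: less_eps0.rep_eq)
    next
      assume "\<exists>\<alpha> < \<beta>. \<exists>n. CNF xs < CNF (replicate n (Rep_eps0 \<alpha>))"
      then obtain \<alpha> n where "\<alpha> < \<beta>" "CNF xs < CNF (replicate n (Rep_eps0 \<alpha>))" by blast
      then show "x < Rep_eps0 \<beta>" by (cases n) (auto simp: less_eps0.rep_eq)
    qed
    then show ?thesis using \<open>\<xi> \<noteq> 0\<close> xs
      by (simp add: less_eps0.rep_eq omega_pow.rep_eq Rep_omega_pow_mult)
  qed
qed

lemma less_omega_pow_self: "\<xi> < omega_pow \<xi>"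
proof transfer
  fix x :: cnf
  show "x < CNF [x]"
  proof (induction x)
    case (CNF as)
    show ?case
    proof (cases as)
      case (Cons a as')
      have "CNF [a] \<le> CNF as" unfolding not_less[symmetric] Cons by simp
      moreover have "a < CNF [a]" using CNF Cons by simp
      ultimately show ?thesis using Cons by (auto dest: less_le_trans)
    qed simp
  qed
qed

lemma finite_ord_norm: "finite {\<alpha>. ord_norm \<alpha> = n}"
proof -
  have fin: "finite {x. cnf_norm x \<le> m}" for m
  proof (induction m)
    case 0
    have "{x. cnf_norm x \<le> 0} \<subseteq> {CNF []}"
    proof
      fix x show "x \<in> {x. cnf_norm x \<le> 0} \<Longrightarrow> x \<in> {CNF []}" by (cases x) simp
    qed
    then show ?case by (rule finite_subset) simp
  next
    case (Suc m)
    have "{x. cnf_norm x \<le> Suc m} \<subseteq>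
        CNF ` {as. set as \<subseteq> {x. cnf_norm x \<le> m} \<and> length as \<le> Suc m}"
    proof
      fix x assume "x \<in> {x. cnf_norm x \<le> Suc m}"
      moreover obtain as where x: "x = CNF as" by (cases x)
      ultimately have le: "length as + sum_list (map cnf_norm as) \<le> Suc m" by simp
      have "cnf_norm a \<le> m" if "a \<in> set as" for a
      proof -
        have "cnf_norm a \<le> sum_list (map cnf_norm as)"
          using that by (intro member_le_sum_list) auto
        moreover have "length as > 0" using that by auto
        ultimately show ?thesis using le by linarith
      qed
      then show "x \<in> CNF ` {as. set as \<subseteq> {x. cnf_norm x \<le> m} \<and> length as \<le> Suc m}"
        using le x by auto
    qed
    then show ?case
      by (rule finite_subset) (intro finite_imageI finite_lists_length_le Suc)
  qed
  have "finite (Rep_eps0 -` {x. cnf_norm x \<le> n})"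
    by (rule finite_vimageI[OF fin]) (simp add: inj_on_def Rep_eps0_inject)
  then show ?thesis by (rule finite_subset[rotated]) (auto simp: ord_norm.rep_eq)
qed

lemma ex_ord_norm: "\<exists>\<alpha> < omega. ord_norm \<alpha> = n"
proof (intro exI conjI)
  let ?\<alpha> = "sum_list (replicate n (omega_pow 0))"
  show "?\<alpha> < omega"
    unfolding omega_def less_eps0.rep_eq Rep_omega_pow_mult omega_pow.rep_eq zero_eps0.rep_eq
    by (cases n) auto
  show "ord_norm ?\<alpha> = n"
    by (simp add: ord_norm.rep_eq Rep_omega_pow_mult zero_eps0.rep_eq sum_list_replicate)
qed

section \<open>Monadic second order logic of linear orders\<close>

text \<open>First order variables and set variables are named by separate copies of \<^typ>\<open>nat\<close>.\<close>

datatype mso =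
    Less nat nat
  | Equal nat nat
  | Member nat nat
  | Neg mso
  | Conj mso mso
  | Ex_elem nat mso
  | Ex_set nat mso

primrec free_elems :: "mso \<Rightarrow> nat set" where
  "free_elems (Less x y) = {x, y}"
| "free_elems (Equal x y) = {x, y}"
| "free_elems (Member x X) = {x}"
| "free_elems (Neg \<phi>) = free_elems \<phi>"
| "free_elems (Conj \<phi> \<psi>) = free_elems \<phi> \<union> free_elems \<psi>"
| "free_elems (Ex_elem x \<phi>) = free_elems \<phi> - {x}"
| "free_elems (Ex_set X \<phi>) = free_elems \<phi>"

primrec free_sets :: "mso \<Rightarrow> nat set" where
  "free_sets (Less x y) = {}"
| "free_sets (Equal x y) = {}"
| "free_sets (Member x X) = {X}"
| "free_sets (Neg \<phi>) = free_sets \<phi>"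
| "free_sets (Conj \<phi> \<psi>) = free_sets \<phi> \<union> free_sets \<psi>"
| "free_sets (Ex_elem x \<phi>) = free_sets \<phi>"
| "free_sets (Ex_set X \<phi>) = free_sets \<phi> - {X}"

definition sentence :: "mso \<Rightarrow> bool" where
  "sentence \<phi> \<longleftrightarrow> free_elems \<phi> = {} \<and> free_sets \<phi> = {}"

text \<open>
  Satisfaction in the structure \<open>\<langle>D, <\<rangle>\<close>. Quantifiers range over \<open>D\<close> and over the subsets of
  \<open>D\<close>; the domain may be empty.
\<close>

primrec holds ::
  "'a::linorder set \<Rightarrow> (nat \<Rightarrow> 'a) \<Rightarrow> (nat \<Rightarrow> 'a set) \<Rightarrow> mso \<Rightarrow> bool" where
  "holds D e E (Less x y) \<longleftrightarrow> e x < e y"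
| "holds D e E (Equal x y) \<longleftrightarrow> e x = e y"
| "holds D e E (Member x X) \<longleftrightarrow> e x \<in> E X"
| "holds D e E (Neg \<phi>) \<longleftrightarrow> \<not> holds D e E \<phi>"
| "holds D e E (Conj \<phi> \<psi>) \<longleftrightarrow> holds D e E \<phi> \<and> holds D e E \<psi>"
| "holds D e E (Ex_elem x \<phi>) \<longleftrightarrow> (\<exists>a \<in> D. holds D (e(x := a)) E \<phi>)"
| "holds D e E (Ex_set X \<phi>) \<longleftrightarrow> (\<exists>A. A \<subseteq> D \<and> holds D e (E(X := A)) \<phi>)"

lemma holds_cong:
  assumes "\<And>x. x \<in> free_elems \<phi> \<Longrightarrow> e x = e' x"
    and "\<And>X. X \<in> free_sets \<phi> \<Longrightarrow> E X = E' X"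
  shows "holds D e E \<phi> \<longleftrightarrow> holds D e' E' \<phi>"
  using assms
proof (induction \<phi> arbitrary: e e' E E')
  case (Neg \<phi>)
  have "holds D e E \<phi> = holds D e' E' \<phi>"
    by (rule Neg.IH) (simp_all add: Neg.prems)
  then show ?case by simp
next
  case (Conj \<phi> \<psi>)
  have "holds D e E \<phi> = holds D e' E' \<phi>"
    by (rule Conj.IH) (simp_all add: Conj.prems)
  moreover have "holds D e E \<psi> = holds D e' E' \<psi>"
    by (rule Conj.IH) (simp_all add: Conj.prems)
  ultimately show ?case by simp
next
  case (Ex_elem x \<phi>)
  have "holds D (e(x := a)) E \<phi> = holds D (e'(x := a)) E' \<phi>" for a
    by (rule Ex_elem.IH) (simp_all add: Ex_elem.prems)
  then show ?case by simp
next
  case (Ex_set X \<phi>)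
  have "holds D e (E(X := A)) \<phi> = holds D e' (E'(X := A)) \<phi>" for A
    by (rule Ex_set.IH) (simp_all add: Ex_set.prems)
  then show ?case by simp
qed simp_all

lemma holds_sentence: "sentence \<phi> \<Longrightarrow> holds D e E \<phi> \<longleftrightarrow> holds D e' E' \<phi>"
  by (rule holds_cong) (auto simp: sentence_def)

text \<open>
  An ordinal is identified with the set of smaller ordinals. For a sentence, the assignment
  chosen here is irrelevant by \<open>holds_sentence\<close>.
\<close>

definition satisfies :: "eps0 \<Rightarrow> mso \<Rightarrow> bool" (infix "\<Turnstile>" 50) where
  "\<alpha> \<Turnstile> \<phi> \<longleftrightarrow> holds {..<\<alpha>} (\<lambda>_. 0) (\<lambda>_. {}) \<phi>"

definition delta :: "mso \<Rightarrow> eps0 \<Rightarrow> nat \<Rightarrow> real" where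
  "delta \<phi> \<beta> n =
     real (card {\<alpha>. \<alpha> < \<beta> \<and> \<alpha> \<Turnstile> \<phi> \<and> ord_norm \<alpha> = n}) /
     real (card {\<alpha>. \<alpha> < \<beta> \<and> ord_norm \<alpha> = n})"

end

theory Submission
  imports Defs "HOL-Library.Nat_Bijection" "HOL-Computational_Algebra.Polynomial"
begin

text \<open>
  Whether \<open>\<gamma> + \<rho> \<Turnstile> \<phi>\<close> depends on \<open>\<gamma>\<close> only through one of finitely many classes, so the set
  \<open>A = {\<alpha>. \<alpha> \<Turnstile> \<phi>}\<close> has finitely many left residuals \<open>{\<rho>. \<gamma> + \<rho> \<in> A}\<close>. Splitting off the leading
  term of an ordinal, and using \<open>\<omega>\<^bsup>d\<^esup> + \<omega>\<^bsup>d + 1\<^esup> = \<omega>\<^bsup>d + 1\<^esup>\<close>, one obtains a finite system of linear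
  recurrences for the numbers \<open>#{\<alpha> < \<beta>. \<alpha> \<in> A, N \<alpha> = n}\<close> over all residuals, whose solutions are
  eventually quasi-polynomials in \<open>n\<close> with rational coefficients. Along each residue class of \<open>n\<close>
  modulo a common period, \<open>\<delta>\<close> is therefore a bounded quotient of rational polynomials and has a
  rational limit; the Cesaro limit is the mean of these limits.
\<close>

section \<open>Finitely many residuals of definable sets\<close>

text \<open>
  Element variables denote sets, so that a valuation of an ordered sum splits into valuations of the
  summands; the element variables having their value in the other summand denote the empty set.
\<close>
primrec set_holds ::
  "'a::linorder set \<Rightarrow> (nat \<Rightarrow> 'a set) \<Rightarrow> (nat \<Rightarrow> 'a set) \<Rightarrow> mso \<Rightarrow> bool" where
  "set_holds D F G (Less x y) \<longleftrightarrow> (\<exists>a \<in> F x. \<exists>b \<in> F y. a < b)"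
| "set_holds D F G (Equal x y) \<longleftrightarrow> F x \<inter> F y \<noteq> {}"
| "set_holds D F G (Member x X) \<longleftrightarrow> F x \<inter> G X \<noteq> {}"
| "set_holds D F G (Neg \<phi>) \<longleftrightarrow> \<not> set_holds D F G \<phi>"
| "set_holds D F G (Conj \<phi> \<psi>) \<longleftrightarrow> set_holds D F G \<phi> \<and> set_holds D F G \<psi>"
| "set_holds D F G (Ex_elem x \<phi>) \<longleftrightarrow> (\<exists>a \<in> D. set_holds D (F(x := {a})) G \<phi>)"
| "set_holds D F G (Ex_set X \<phi>) \<longleftrightarrow> (\<exists>A. A \<subseteq> D \<and> set_holds D F (G(X := A)) \<phi>)"

lemma holds_iff_set_holds: "holds D e E \<phi> \<longleftrightarrow> set_holds D (\<lambda>x. {e x}) E \<phi>"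
proof (induction \<phi> arbitrary: e E)
  case (Ex_elem x \<phi>)
  have "(\<lambda>y. {(e(x := a)) y}) = (\<lambda>y. {e y})(x := {a})" for a by (rule ext) simp
  with Ex_elem show ?case by simp
qed auto

section \<open>Valuations of ordered sums\<close>

type_synonym assignment = "nat \<Rightarrow> eps0 set"

text \<open>The valuation of an ordered sum: \<open>F\<close> lives on the left summand
  \<open>\<gamma>\<close>, and \<open>H\<close> on the right one, shifted behind
  \<open>\<gamma>\<close>. It serves element variables and set variables alike.\<close>

definition glue :: "eps0 \<Rightarrow> assignment \<Rightarrow> assignment \<Rightarrow> assignment" where
  "glue \<gamma> F H = (\<lambda>x. F x \<union> (+) \<gamma> ` H x)"

text \<open>Carries a quantified value, split along the cut at \<open>\<gamma>\<close>, into the two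
  halves of the valuation, so that \<open>nerode\<close> applies to the matrix of a quantified
  formula.\<close>

lemma glue_upd: "(glue \<gamma> F H)(x := A \<union> (+) \<gamma> ` B) = glue \<gamma> (F(x := A)) (H(x := B))"
  by (rule ext) (simp add: glue_def)

lemma le_plus: "\<gamma> \<le> \<gamma> + (\<eta> :: eps0)"
  using less_plus_iff[of "\<gamma> + \<eta>" \<gamma> \<eta>] plus_strict_mono[of 0 \<eta> \<gamma>] eps0_zero_le[of \<eta>]
  by (metis eps0_plus_zero less_imp_le order.order_iff_strict)

lemma plus_less_iff [simp]: "\<gamma> + \<eta> < \<gamma> + \<eta>' \<longleftrightarrow> \<eta> < (\<eta>' :: eps0)"
  by (metis linorder_less_linear order_less_asym plus_strict_mono)

lemma plus_eq_iff [simp]: "\<gamma> + \<eta> = \<gamma> + \<eta>' \<longleftrightarrow> \<eta> = (\<eta>' :: eps0)"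
  by (metis plus_strict_mono less_irrefl linorder_less_linear)

lemma lessThan_plus: "{..<\<gamma> + \<eta>} = {..<\<gamma>} \<union> (+) \<gamma> ` {..<\<eta> :: eps0}"
  by (auto simp: less_plus_iff image_iff)

text \<open>
  A Nerode congruence: structures with the same value of \<open>h\<close> behave alike as initial segments.
\<close>
definition nerode :: "(eps0 \<Rightarrow> assignment \<Rightarrow> assignment \<Rightarrow> nat) \<Rightarrow> mso \<Rightarrow> bool" where
  "nerode h \<phi> \<longleftrightarrow> (\<forall>\<gamma> F G \<gamma>' F' G' \<eta> H K.
    (\<forall>x. F x \<subseteq> {..<\<gamma>}) \<longrightarrow> (\<forall>X. G X \<subseteq> {..<\<gamma>}) \<longrightarrow>
    (\<forall>x. F' x \<subseteq> {..<\<gamma>'}) \<longrightarrow> (\<forall>X. G' X \<subseteq> {..<\<gamma>'}) \<longrightarrow>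
    h \<gamma> F G = h \<gamma>' F' G' \<longrightarrow>
    set_holds {..<\<gamma> + \<eta>} (glue \<gamma> F H) (glue \<gamma> G K) \<phi> \<longrightarrow>
    set_holds {..<\<gamma>' + \<eta>} (glue \<gamma>' F' H) (glue \<gamma>' G' K) \<phi>)"

lemma nerodeI:
  assumes "\<And>\<gamma> F G \<gamma>' F' G' \<eta> H K.
    \<lbrakk>\<And>x. F x \<subseteq> {..<\<gamma>}; \<And>X. G X \<subseteq> {..<\<gamma>}; \<And>x. F' x \<subseteq> {..<\<gamma>'}; \<And>X. G' X \<subseteq> {..<\<gamma>'};
     h \<gamma> F G = h \<gamma>' F' G'; set_holds {..<\<gamma> + \<eta>} (glue \<gamma> F H) (glue \<gamma> G K) \<phi>\<rbrakk> \<Longrightarrow>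
     set_holds {..<\<gamma>' + \<eta>} (glue \<gamma>' F' H) (glue \<gamma>' G' K) \<phi>"
  shows "nerode h \<phi>"
  unfolding nerode_def by (intro allI impI) (rule assms; simp)

lemma nerodeD:
  assumes "nerode h \<phi>"
    "\<And>x. F x \<subseteq> {..<\<gamma>}" "\<And>X. G X \<subseteq> {..<\<gamma>}" "\<And>x. F' x \<subseteq> {..<\<gamma>'}" "\<And>X. G' X \<subseteq> {..<\<gamma>'}"
    "h \<gamma> F G = h \<gamma>' F' G'" "set_holds {..<\<gamma> + \<eta>} (glue \<gamma> F H) (glue \<gamma> G K) \<phi>"
  shows "set_holds {..<\<gamma>' + \<eta>} (glue \<gamma>' F' H) (glue \<gamma>' G' K) \<phi>"
  using assms(1)[unfolded nerode_def, rule_format, OF assms(2-7)] .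

text \<open>The classes are natural numbers, so that one fixed type serves all formulas; sets and
  pairs of classes are coded by \<open>set_encode\<close> and \<open>prod_encode\<close>. The bound
  \<open>A\<close> covers all arguments of \<open>h\<close>, also values lying outside
  \<open>{..<\<gamma>}\<close>.\<close>

definition finite_index :: "mso \<Rightarrow> bool" where
  "finite_index \<phi> \<longleftrightarrow> (\<exists>h A. finite A \<and> (\<forall>\<gamma> F G. h \<gamma> F G \<in> A) \<and> nerode h \<phi>)"

lemma finite_indexI:
  assumes "finite A" "\<And>\<gamma> F G. h \<gamma> F G \<in> A" "nerode h \<phi>"
  shows "finite_index \<phi>"
  using assms unfolding finite_index_def by blast

section \<open>Atomic formulas\<close>

lemma finite_index_Less: "finite_index (Less x y)"
proof (rule finite_indexI[OF _ _ nerodeI])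
  let ?h = "\<lambda>\<gamma> F G. set_encode ((if F x \<noteq> {} then {0} else {}) \<union> (if F y \<noteq> {} then {1} else {}) \<union>
    (if \<exists>a \<in> F x. \<exists>b \<in> F y. a < b then {2} else {})) :: nat"
  show "finite (set_encode ` Pow {0, 1, 2})" by simp
  show "?h \<gamma> F G \<in> set_encode ` Pow {0, 1, 2}" for \<gamma> and F G :: "nat \<Rightarrow> eps0 set"
    by (rule imageI) auto
  fix \<gamma> \<gamma>' \<eta> and F G F' G' H K :: "nat \<Rightarrow> eps0 set"
  assume sub: "\<And>x. F x \<subseteq> {..<\<gamma>}" "\<And>x. F' x \<subseteq> {..<\<gamma>'}"
  assume "?h \<gamma> F G = ?h \<gamma>' F' G'"
  then have eq: "(F x \<noteq> {}) = (F' x \<noteq> {})" "(F y \<noteq> {}) = (F' y \<noteq> {})"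
    "(\<exists>a \<in> F x. \<exists>b \<in> F y. a < b) = (\<exists>a \<in> F' x. \<exists>b \<in> F' y. a < b)"
    by (subst (asm) set_encode_eq; force split: if_splits)+
  \<comment> \<open>Every element left of the cut lies below every element right of it. Hence a
    mixed pair exists as soon as both sets are non-empty, and the three recorded bits settle the
    formula.\<close>
  have char: "(\<exists>a \<in> glue \<gamma> F H x. \<exists>b \<in> glue \<gamma> F H y. a < b) \<longleftrightarrow>
    (\<exists>a \<in> F x. \<exists>b \<in> F y. a < b) \<or> F x \<noteq> {} \<and> H y \<noteq> {} \<or> (\<exists>a \<in> H x. \<exists>b \<in> H y. a < b)"
    if sub: "\<And>x. F x \<subseteq> {..<\<gamma>}" for \<gamma> F
  proof -
    have 1: "a < \<gamma> + b" if "a \<in> F z" for a b z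
      using that sub le_plus[of \<gamma> b] by (metis lessThan_iff order_less_le_trans subsetD)
    then have 2: "\<not> \<gamma> + b < a" if "a \<in> F z" for a b z using that by (metis less_asym)
    show ?thesis using 1 2 by (auto simp: glue_def bex_Un)
  qed
  show "set_holds {..<\<gamma> + \<eta>} (glue \<gamma> F H) (glue \<gamma> G K) (Less x y) \<Longrightarrow>
    set_holds {..<\<gamma>' + \<eta>} (glue \<gamma>' F' H) (glue \<gamma>' G' K) (Less x y)"
    unfolding set_holds.simps char[OF sub(1)] char[OF sub(2)] using eq by auto
qed

text \<open>Left values lie below \<open>\<gamma>\<close> and shifted ones do not, so only parts
  from the same summand can meet. One bit about the left summand therefore suffices for the formulas
  \<open>Equal\<close> and \<open>Member\<close>.\<close>

lemma glue_Int_empty_iff: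
  assumes "\<And>x. F x \<subseteq> {..<\<gamma>}" "\<And>x. G x \<subseteq> {..<\<gamma>}"
  shows "glue \<gamma> F H x \<inter> glue \<gamma> G K y = {} \<longleftrightarrow> F x \<inter> G y = {} \<and> H x \<inter> K y = {}"
proof -
  have "\<gamma> + b \<notin> F x" "\<gamma> + b \<notin> G y" for b
    using assms le_plus[of \<gamma> b] by (meson lessThan_iff not_less subsetD)+
  then show ?thesis by (auto simp: glue_def) 
qed

lemma finite_index_Equal: "finite_index (Equal x y)"
proof (rule finite_indexI[OF _ _ nerodeI])
  let ?h = "\<lambda>\<gamma> F G. (if F x \<inter> F y = {} then 0 else 1) :: nat"
  show "finite {0, 1 :: nat}" by simp
  show "?h \<gamma> F G \<in> {0, 1}" for \<gamma> and F G :: "nat \<Rightarrow> eps0 set" by auto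
  show "set_holds {..<\<gamma>' + \<eta>} (glue \<gamma>' F' H) (glue \<gamma>' G' K) (Equal x y)"
    if "\<And>x. F x \<subseteq> {..<\<gamma>}" "\<And>x. F' x \<subseteq> {..<\<gamma>'}" "?h \<gamma> F G = ?h \<gamma>' F' G'"
      "set_holds {..<\<gamma> + \<eta>} (glue \<gamma> F H) (glue \<gamma> G K) (Equal x y)"
    for \<gamma> \<gamma>' \<eta> and F G F' G' H K :: "nat \<Rightarrow> eps0 set"
    using that by (simp add: glue_Int_empty_iff split: if_splits)
qed

lemma finite_index_Member: "finite_index (Member x X)"
proof (rule finite_indexI[OF _ _ nerodeI])
  let ?h = "\<lambda>\<gamma> F G. (if F x \<inter> G X = {} then 0 else 1) :: nat"
  show "finite {0, 1 :: nat}" by simp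
  show "?h \<gamma> F G \<in> {0, 1}" for \<gamma> and F G :: "nat \<Rightarrow> eps0 set" by auto
  show "set_holds {..<\<gamma>' + \<eta>} (glue \<gamma>' F' H) (glue \<gamma>' G' K) (Member x X)"
    if "\<And>x. F x \<subseteq> {..<\<gamma>}" "\<And>x. G x \<subseteq> {..<\<gamma>}" "\<And>x. F' x \<subseteq> {..<\<gamma>'}" "\<And>x. G' x \<subseteq> {..<\<gamma>'}"
      "?h \<gamma> F G = ?h \<gamma>' F' G'"
      "set_holds {..<\<gamma> + \<eta>} (glue \<gamma> F H) (glue \<gamma> G K) (Member x X)"
    for \<gamma> \<gamma>' \<eta> and F G F' G' H K :: "nat \<Rightarrow> eps0 set"
    using that by (simp add: glue_Int_empty_iff split: if_splits)
qed

section \<open>Connectives and quantifiers\<close>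

lemma finite_index_Neg:
  assumes "finite_index \<phi>"
  shows "finite_index (Neg \<phi>)"
proof -
  obtain h A where h: "finite A" "\<And>\<gamma> F G. h \<gamma> F G \<in> A"
    and h': "nerode h \<phi>"
    using assms unfolding finite_index_def by blast
  show ?thesis
  proof (rule finite_indexI[OF h nerodeI])
    fix \<gamma> \<gamma>' \<eta> F G F' G' H K
    assume *: "\<And>x. F x \<subseteq> {..<\<gamma>}" "\<And>X. G X \<subseteq> {..<\<gamma>}" "\<And>x. F' x \<subseteq> {..<\<gamma>'}" "\<And>X. G' X \<subseteq> {..<\<gamma>'}"
      and eq: "h \<gamma> F G = h \<gamma>' F' G'"
      and holds: "set_holds {..<\<gamma> + \<eta>} (glue \<gamma> F H) (glue \<gamma> G K) (Neg \<phi>)"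
    \<comment> \<open>\<open>nerode\<close> demands only an implication, but equality of classes is
      symmetric; exchanging the two structures gives the converse, which negation requires.\<close>
    show "set_holds {..<\<gamma>' + \<eta>} (glue \<gamma>' F' H) (glue \<gamma>' G' K) (Neg \<phi>)"
      using holds nerodeD[OF h' *(3,4,1,2) eq[symmetric]] by auto
  qed
qed

lemma finite_index_Conj:
  assumes "finite_index \<phi>" "finite_index \<psi>"
  shows "finite_index (Conj \<phi> \<psi>)"
proof -
  obtain h A where h: "finite A" "\<And>\<gamma> F G. h \<gamma> F G \<in> A"
    and h': "nerode h \<phi>"
    using assms(1) unfolding finite_index_def by blast
  obtain k B where k: "finite B" "\<And>\<gamma> F G. k \<gamma> F G \<in> B"
    and k': "nerode k \<psi>"
    using assms(2) unfolding finite_index_def by blast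
  show ?thesis
  proof (rule finite_indexI[OF _ _ nerodeI])
    let ?h = "\<lambda>\<gamma> F G. prod_encode (h \<gamma> F G, k \<gamma> F G)"
    show "finite (prod_encode ` (A \<times> B))" using h k by simp
    show "?h \<gamma> F G \<in> prod_encode ` (A \<times> B)" for \<gamma> F G using h k by auto
    fix \<gamma> \<gamma>' \<eta> F G F' G' H K
    assume *: "\<And>x. F x \<subseteq> {..<\<gamma>}" "\<And>X. G X \<subseteq> {..<\<gamma>}" "\<And>x. F' x \<subseteq> {..<\<gamma>'}" "\<And>X. G' X \<subseteq> {..<\<gamma>'}"
      and "?h \<gamma> F G = ?h \<gamma>' F' G'"
      and holds: "set_holds {..<\<gamma> + \<eta>} (glue \<gamma> F H) (glue \<gamma> G K) (Conj \<phi> \<psi>)"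
    then have eq: "h \<gamma> F G = h \<gamma>' F' G'" "k \<gamma> F G = k \<gamma>' F' G'" by (auto simp: prod_encode_eq)
    show "set_holds {..<\<gamma>' + \<eta>} (glue \<gamma>' F' H) (glue \<gamma>' G' K) (Conj \<phi> \<psi>)"
      using holds nerodeD[OF h' * eq(1)] nerodeD[OF k' * eq(2)] by simp
  qed
qed

text \<open>
  Power set construction: the class of an initial segment records the classes of its expansions.
\<close>
lemma finite_index_Ex_set:
  assumes "finite_index \<phi>"
  shows "finite_index (Ex_set X \<phi>)"
proof -
  obtain h A where h: "finite A" "\<And>\<gamma> F G. h \<gamma> F G \<in> A"
    and h': "nerode h \<phi>"
    using assms unfolding finite_index_def by blast
  show ?thesis
  proof (rule finite_indexI[OF _ _ nerodeI])
    let ?V = "\<lambda>\<gamma> F G. (\<lambda>C. h \<gamma> F (G(X := C))) ` Pow {..<\<gamma>}"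
    let ?h = "\<lambda>\<gamma> F G. set_encode (?V \<gamma> F G)"
    have V: "?V \<gamma> F G \<subseteq> A" for \<gamma> F G using h(2) by auto
    show "finite (set_encode ` Pow A)" using h by simp
    show "?h \<gamma> F G \<in> set_encode ` Pow A" for \<gamma> F G
      using V[of \<gamma> F G] by blast
    fix \<gamma> \<gamma>' \<eta> F G F' G' H K
    assume *: "\<And>x. F x \<subseteq> {..<\<gamma>}" "\<And>X. G X \<subseteq> {..<\<gamma>}" "\<And>x. F' x \<subseteq> {..<\<gamma>'}" "\<And>X. G' X \<subseteq> {..<\<gamma>'}"
      and "?h \<gamma> F G = ?h \<gamma>' F' G'"
      and holds: "set_holds {..<\<gamma> + \<eta>} (glue \<gamma> F H) (glue \<gamma> G K) (Ex_set X \<phi>)"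
    then have eq: "?V \<gamma> F G = ?V \<gamma>' F' G'"
      by (subst (asm) set_encode_eq) (auto intro: finite_subset[OF V h(1)])
    from holds obtain C where C: "C \<subseteq> {..<\<gamma>} \<union> (+) \<gamma> ` {..<\<eta>}"
      and holds_C: "set_holds {..<\<gamma> + \<eta>} (glue \<gamma> F H) ((glue \<gamma> G K)(X := C)) \<phi>"
      by (auto simp: lessThan_plus)
    \<comment> \<open>The witness is cut at \<open>\<gamma>\<close>. Its left part is replaced by a
      set \<open>B\<close> of the same class below \<open>\<gamma>'\<close>, while its right part is
      kept.\<close>
    define C1 C2 where "C1 = C \<inter> {..<\<gamma>}" and "C2 = {\<zeta> \<in> {..<\<eta>}. \<gamma> + \<zeta> \<in> C}"
    have C': "C = C1 \<union> (+) \<gamma> ` C2" using C by (auto simp: C1_def C2_def)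
    have "h \<gamma> F (G(X := C1)) \<in> ?V \<gamma> F G" by (auto simp: C1_def)
    then obtain B where B: "B \<subseteq> {..<\<gamma>'}" "h \<gamma> F (G(X := C1)) = h \<gamma>' F' (G'(X := B))"
      unfolding eq by auto
    have "set_holds {..<\<gamma>' + \<eta>} (glue \<gamma>' F' H) (glue \<gamma>' (G'(X := B)) (K(X := C2))) \<phi>"
    proof (rule nerodeD[OF h' _ _ _ _ B(2)])
      show "set_holds {..<\<gamma> + \<eta>} (glue \<gamma> F H) (glue \<gamma> (G(X := C1)) (K(X := C2))) \<phi>"
        using holds_C unfolding C' glue_upd .
    qed (use * B in \<open>auto simp: C1_def\<close>)
    moreover have "B \<union> (+) \<gamma>' ` C2 \<subseteq> {..<\<gamma>' + \<eta>}"
      using B by (auto simp: lessThan_plus C2_def)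
    ultimately show "set_holds {..<\<gamma>' + \<eta>} (glue \<gamma>' F' H) (glue \<gamma>' G' K) (Ex_set X \<phi>)"
      unfolding glue_upd[symmetric] set_holds.simps by blast
  qed
qed

text \<open>The witness lies in one summand only, and the other one then sees the empty set for
  \<open>x\<close>. So the class records the classes of all expansions by a singleton and, for a
  witness on the right, the class of the expansion by \<open>{}\<close>.\<close>

lemma finite_index_Ex_elem:
  assumes "finite_index \<phi>"
  shows "finite_index (Ex_elem x \<phi>)"
proof -
  obtain h A where h: "finite A" "\<And>\<gamma> F G. h \<gamma> F G \<in> A"
    and h': "nerode h \<phi>"
    using assms unfolding finite_index_def by blast
  show ?thesis
  proof (rule finite_indexI[OF _ _ nerodeI])
    let ?V = "\<lambda>\<gamma> F G. (\<lambda>a. h \<gamma> (F(x := {a})) G) ` {..<\<gamma>}"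
    let ?h = "\<lambda>\<gamma> F G. prod_encode (set_encode (?V \<gamma> F G), h \<gamma> (F(x := {})) G)"
    have V: "?V \<gamma> F G \<subseteq> A" for \<gamma> F G using h(2) by auto
    show "finite (prod_encode ` (set_encode ` Pow A \<times> A))" using h by simp
    show "?h \<gamma> F G \<in> prod_encode ` (set_encode ` Pow A \<times> A)" for \<gamma> F G
      using V[of \<gamma> F G] h(2) by blast
    fix \<gamma> \<gamma>' \<eta> F G F' G' H K
    assume *: "\<And>x. F x \<subseteq> {..<\<gamma>}" "\<And>X. G X \<subseteq> {..<\<gamma>}" "\<And>x. F' x \<subseteq> {..<\<gamma>'}" "\<And>X. G' X \<subseteq> {..<\<gamma>'}"
      and "?h \<gamma> F G = ?h \<gamma>' F' G'"
      and holds: "set_holds {..<\<gamma> + \<eta>} (glue \<gamma> F H) (glue \<gamma> G K) (Ex_elem x \<phi>)"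
    then have eq: "?V \<gamma> F G = ?V \<gamma>' F' G'" and eq': "h \<gamma> (F(x := {})) G = h \<gamma>' (F'(x := {})) G'"
      by (simp_all add: prod_encode_eq, subst (asm) set_encode_eq)
        (auto intro: finite_subset[OF V h(1)])
    from holds obtain a where "a < \<gamma> + \<eta>"
      and holds_a: "set_holds {..<\<gamma> + \<eta>} ((glue \<gamma> F H)(x := {a})) (glue \<gamma> G K) \<phi>"
      by auto
    then consider "a < \<gamma>" | \<zeta> where "\<zeta> < \<eta>" "a = \<gamma> + \<zeta>" by (auto simp: less_plus_iff)
    then show "set_holds {..<\<gamma>' + \<eta>} (glue \<gamma>' F' H) (glue \<gamma>' G' K) (Ex_elem x \<phi>)"
    proof cases
      case 1
      then have "h \<gamma> (F(x := {a})) G \<in> ?V \<gamma> F G" by auto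
      then obtain b where b: "b < \<gamma>'" "h \<gamma> (F(x := {a})) G = h \<gamma>' (F'(x := {b})) G'"
        unfolding eq by auto
      have "set_holds {..<\<gamma>' + \<eta>} (glue \<gamma>' (F'(x := {b})) (H(x := {}))) (glue \<gamma>' G' K) \<phi>"
      proof (rule nerodeD[OF h' _ _ _ _ b(2)])
        show "set_holds {..<\<gamma> + \<eta>} (glue \<gamma> (F(x := {a})) (H(x := {}))) (glue \<gamma> G K) \<phi>"
          using holds_a by (simp flip: glue_upd)
      qed (use * b 1 in auto)
      then show ?thesis using b(1) by (auto simp flip: glue_upd simp: less_plus_iff)
    next
      case 2
      have "set_holds {..<\<gamma>' + \<eta>} (glue \<gamma>' (F'(x := {})) (H(x := {\<zeta>}))) (glue \<gamma>' G' K) \<phi>"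
      proof (rule nerodeD[OF h' _ _ _ _ eq'])
        show "set_holds {..<\<gamma> + \<eta>} (glue \<gamma> (F(x := {})) (H(x := {\<zeta>}))) (glue \<gamma> G K) \<phi>"
          using holds_a 2 by (simp flip: glue_upd)
      qed (use * in auto)
      then show ?thesis using 2 by (auto simp flip: glue_upd)
    qed
  qed
qed

lemma finite_index: "finite_index \<phi>"
  by (induction \<phi>) (simp_all add: finite_index_Less finite_index_Equal finite_index_Member
      finite_index_Neg finite_index_Conj finite_index_Ex_set finite_index_Ex_elem)

text \<open>The left quotient of a language, with ordinals as words and addition as
  concatenation.\<close>

definition residual :: "eps0 \<Rightarrow> eps0 set \<Rightarrow> eps0 set" where
  "residual \<gamma> A = {\<rho>. \<gamma> + \<rho> \<in> A}"

lemma residual_residual: "residual \<gamma> (residual \<delta> A) = residual (\<delta> + \<gamma>) A"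
  by (simp add: residual_def add.assoc)

theorem finite_residuals_satisfies: "finite (range (\<lambda>\<gamma>. residual \<gamma> {\<alpha>. \<alpha> \<Turnstile> \<phi>}))"
proof -
  obtain h A where h: "finite A" "\<And>\<gamma> F G. h \<gamma> F G \<in> A"
    and h': "nerode h \<phi>"
    using finite_index[of \<phi>] unfolding finite_index_def by blast
  let ?R = "\<lambda>\<gamma>. residual \<gamma> {\<alpha>. \<alpha> \<Turnstile> \<phi>}"
  let ?h = "\<lambda>\<gamma>. h \<gamma> (\<lambda>_. {0}) (\<lambda>_. {})"
  have sat: "\<gamma> + \<rho> \<Turnstile> \<phi> \<longleftrightarrow>
      set_holds {..<\<gamma> + \<rho>} (glue \<gamma> (\<lambda>_. {0}) (\<lambda>_. {})) (glue \<gamma> (\<lambda>_. {}) (\<lambda>_. {})) \<phi>" for \<gamma> \<rho>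
    by (simp add: satisfies_def holds_iff_set_holds glue_def)
  \<comment> \<open>\<open>satisfies\<close> gives all element variables the value 0, which belongs
    to the left summand only if \<open>0 < \<gamma>\<close>. The case \<open>\<gamma> = 0\<close> is
    set aside and accounts for the one extra residual inserted below.\<close>
  have imp: "?R \<gamma> \<subseteq> ?R \<gamma>'" if "?h \<gamma> = ?h \<gamma>'" "0 < \<gamma>" "0 < \<gamma>'" for \<gamma> \<gamma>'
    unfolding residual_def using that by (auto simp only: sat mem_Collect_eq intro: nerodeD[OF h' _ _ _ _ that(1)])
  \<comment> \<open>By \<open>imp\<close> in both directions the residual depends only on the class,
    so that of any chosen representative will do.\<close>
  have "\<exists>R. \<forall>\<gamma>. 0 < \<gamma> \<longrightarrow> ?R \<gamma> = R (?h \<gamma>)"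
    by (rule exI[of _ "\<lambda>v. ?R (SOME \<gamma>. 0 < \<gamma> \<and> ?h \<gamma> = v)"], intro allI impI)
      (rule someI2, force, (intro equalityI imp; simp))
  then obtain R where R: "\<And>\<gamma>. 0 < \<gamma> \<Longrightarrow> ?R \<gamma> = R (?h \<gamma>)" by blast
  have "range ?R \<subseteq> insert (?R 0) (R ` A)"
  proof
    fix B assume "B \<in> range ?R"
    then obtain \<gamma> where "B = ?R \<gamma>" by blast
    then show "B \<in> insert (?R 0) (R ` A)"
      using R[of \<gamma>] h(2) eps0_zero_le[of \<gamma>] by (cases "\<gamma> = 0") (auto simp: order.strict_iff_order)
  qed
  then show ?thesis using h(1) finite_subset by blast
qed

section \<open>Quasi-polynomials\<close>

definition quasi_poly_mod :: "nat \<Rightarrow> (nat \<Rightarrow> rat) \<Rightarrow> bool" where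
  "quasi_poly_mod p f \<longleftrightarrow>
    (\<forall>r. \<exists>q. \<forall>\<^sub>F m in sequentially. f (p * m + r) = poly q (of_nat m))"

definition quasi_poly :: "(nat \<Rightarrow> rat) \<Rightarrow> bool" where
  "quasi_poly f \<longleftrightarrow> (\<exists>p>0. quasi_poly_mod p f)"

lemma quasi_poly_modE:
  assumes "quasi_poly_mod p f"
  obtains q M where "\<And>m. m \<ge> M \<Longrightarrow> f (p * m + r) = poly q (of_nat m)"
  using assms unfolding quasi_poly_mod_def eventually_sequentially by blast

lemma quasi_poly_mod_mult:
  assumes "quasi_poly_mod p f" "l > 0"
  shows "quasi_poly_mod (p * l) f"
  unfolding quasi_poly_mod_def
proof
  fix r
  obtain q M where q: "\<And>m. m \<ge> M \<Longrightarrow> f (p * m + r) = poly q (of_nat m)"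
    by (rule quasi_poly_modE[OF assms(1), where r = r]) (rule that)
  have "f (p * l * m + r) = poly (q \<circ>\<^sub>p [:0, of_nat l:]) (of_nat m)" if "m \<ge> M" for m
  proof -
    have "l * m \<ge> M" using that assms(2) mult_le_mono[of 1 l M m] by simp
    from q[OF this] show ?thesis by (simp add: poly_pcompose mult.assoc mult.commute[of "of_nat m"])
  qed
  then show "\<exists>q. \<forall>\<^sub>F m in sequentially. f (p * l * m + r) = poly q (of_nat m)"
    unfolding eventually_sequentially by blast
qed

lemma quasi_poly_common_period:
  assumes "quasi_poly f" "quasi_poly g"
  obtains p where "p > 0" "quasi_poly_mod p f" "quasi_poly_mod p g"
proof -
  obtain p1 p2 where "p1 > 0" "quasi_poly_mod p1 f" "p2 > 0" "quasi_poly_mod p2 g"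
    using assms unfolding quasi_poly_def by blast
  then show thesis
    using quasi_poly_mod_mult[of p1 f p2] quasi_poly_mod_mult[of p2 g p1] that[of "p1 * p2"]
    by (simp add: mult.commute)
qed

lemma quasi_poly_add:
  assumes "quasi_poly f" "quasi_poly g"
  shows "quasi_poly (\<lambda>n. f n + g n)"
proof -
  obtain p where p: "p > 0" "quasi_poly_mod p f" "quasi_poly_mod p g"
    by (rule quasi_poly_common_period[OF assms])
  have "quasi_poly_mod p (\<lambda>n. f n + g n)"
    unfolding quasi_poly_mod_def
  proof
    fix r
    obtain q1 q2 where "\<forall>\<^sub>F m in sequentially. f (p * m + r) = poly q1 (of_nat m)"
      "\<forall>\<^sub>F m in sequentially. g (p * m + r) = poly q2 (of_nat m)"
      using p(2,3) unfolding quasi_poly_mod_def by blast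
    then have "\<forall>\<^sub>F m in sequentially. f (p * m + r) + g (p * m + r) = poly (q1 + q2) (of_nat m)"
      by eventually_elim simp
    then show "\<exists>q. \<forall>\<^sub>F m in sequentially. f (p * m + r) + g (p * m + r) = poly q (of_nat m)" ..
  qed
  then show ?thesis using p(1) unfolding quasi_poly_def by blast
qed

lemma quasi_poly_zero: "quasi_poly (\<lambda>n. 0)"
proof -
  have "quasi_poly_mod 1 (\<lambda>n. 0)" by (auto simp: quasi_poly_mod_def intro!: exI[of _ 0])
  then show ?thesis unfolding quasi_poly_def by blast
qed

lemma quasi_poly_mod_shift: "quasi_poly_mod p f \<Longrightarrow> quasi_poly_mod p (\<lambda>n. f (n + c))"
  unfolding quasi_poly_mod_def by (simp add: add.assoc)

lemma quasi_poly_mod_unshift: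
  assumes "p > 0" "quasi_poly_mod p (\<lambda>n. f (n + c))"
  shows "quasi_poly_mod p f"
  unfolding quasi_poly_mod_def
proof
  fix r
  \<comment> \<open>Adding \<open>c\<close> to the offset \<open>p * c - c + r\<close> gives
    \<open>p * c + r\<close>, since \<open>c \<le> p * c\<close>. So the value at
    \<open>m - c\<close> for this offset is the value of \<open>f\<close> at \<open>m\<close> for
    the offset \<open>r\<close>.\<close>
  obtain q M where q: "\<And>m. m \<ge> M \<Longrightarrow> f (p * m + (p * c - c + r) + c) = poly q (of_nat m)"
    by (rule quasi_poly_modE[OF assms(2), where r = "p * c - c + r"]) (rule that)
  have "f (p * m + r) = poly (q \<circ>\<^sub>p [:- of_nat c, 1:]) (of_nat m)" if "m \<ge> M + c" for m
  proof -
    define m' where "m' = m - c"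
    have m: "m = m' + c" "m' \<ge> M" using that by (simp_all add: m'_def)
    have "c \<le> p * c" using assms(1) by simp
    then have "p * m + r = p * m' + (p * c - c + r) + c"
      unfolding m distrib_left by linarith
    then have "f (p * m + r) = poly q (of_nat m')" using q[OF m(2)] by (simp only:)
    moreover have "of_nat m' = (- of_nat c + of_nat m :: rat)" by (simp add: m(1))
    ultimately show ?thesis by (simp add: poly_pcompose)
  qed
  then show "\<exists>q. \<forall>\<^sub>F m in sequentially. f (p * m + r) = poly q (of_nat m)"
    unfolding eventually_sequentially by blast
qed

lemma quasi_poly_shift_iff: "quasi_poly (\<lambda>n. f (n + c)) \<longleftrightarrow> quasi_poly f"
  unfolding quasi_poly_def using quasi_poly_mod_shift quasi_poly_mod_unshift by blast

section \<open>Antidifferences\<close>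

lemma poly_antidifference_power:
  "\<exists>s :: 'a :: field_char_0 poly. \<forall>x. poly s (x + 1) - poly s x = x ^ n"
proof (induction n rule: less_induct)
  case (less n)
  then obtain S :: "nat \<Rightarrow> 'a poly" where
    S: "\<And>k x. k < n \<Longrightarrow> poly (S k) (x + 1) - poly (S k) x = x ^ k" by metis
  \<comment> \<open>By the binomial theorem the difference of \<open>x ^ Suc n\<close> is
    \<open>Suc n * x ^ n\<close> plus lower powers. Subtracting the antidifferences of these and
    dividing by \<open>Suc n\<close> leaves \<open>x ^ n\<close>.\<close>
  define s where "s = smult (1 / of_nat (Suc n))
    (monom 1 (Suc n) - (\<Sum>k<n. smult (of_nat (Suc n choose k)) (S k)))"
  have "poly s (x + 1) - poly s x = x ^ n" for x
  proof -
    have "(x + 1) ^ Suc n = (\<Sum>k\<le>Suc n. of_nat (Suc n choose k) * x ^ k)"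
      unfolding binomial_ring by simp
    also have "\<dots> = (\<Sum>k<n. of_nat (Suc n choose k) * x ^ k) + of_nat (Suc n) * x ^ n + x ^ Suc n"
      unfolding lessThan_Suc_atMost[symmetric] sum.lessThan_Suc by simp
    also have "(\<Sum>k<n. of_nat (Suc n choose k) * x ^ k) =
        (\<Sum>k<n. of_nat (Suc n choose k) * (poly (S k) (x + 1) - poly (S k) x))"
      using S by simp
    finally have "of_nat (Suc n) * x ^ n = ((x + 1) ^ Suc n - x ^ Suc n) -
        (\<Sum>k<n. of_nat (Suc n choose k) * (poly (S k) (x + 1) - poly (S k) x))" by simp
    also have "\<dots> = of_nat (Suc n) * (poly s (x + 1) - poly s x)"
      unfolding s_def
      by (simp add: poly_sum poly_monom right_diff_distrib sum_subtractf del: of_nat_Suc power_Suc binomial_Suc_Suc)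
    finally show ?thesis by (simp del: of_nat_Suc)
  qed
  then show ?case by blast
qed

lemma poly_antidifference:
  "\<exists>s :: 'a :: field_char_0 poly. \<forall>x. poly s (x + 1) - poly s x = poly q x"
proof -
  obtain S :: "nat \<Rightarrow> 'a poly" where S: "\<And>k x. poly (S k) (x + 1) - poly (S k) x = x ^ k"
    using poly_antidifference_power by metis
  have "poly (\<Sum>k\<le>degree q. smult (coeff q k) (S k)) (x + 1) -
      poly (\<Sum>k\<le>degree q. smult (coeff q k) (S k)) x = poly q x" for x
    unfolding poly_sum poly_smult sum_subtractf[symmetric] right_diff_distrib[symmetric] S
    by (simp add: poly_altdef)
  then show ?thesis by blast
qed

text \<open>On a residue class, a step of \<open>p\<close> in \<open>n\<close> is a step of one in
  \<open>m\<close>. From some point on, \<open>f\<close> therefore differs from a polynomial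
  antidifference by a constant.\<close>

lemma quasi_poly_mod_antidifference:
  assumes "quasi_poly_mod p (\<lambda>n. f (n + p) - f n)"
  shows "quasi_poly_mod p f"
  unfolding quasi_poly_mod_def
proof
  fix r
  obtain q M where q: "\<And>m. m \<ge> M \<Longrightarrow> f (p * m + r + p) - f (p * m + r) = poly q (of_nat m)"
    by (rule quasi_poly_modE[OF assms, where r = r]) (rule that)
  obtain s where s: "\<And>x. poly s (x + 1) - poly s x = poly q x"
    using poly_antidifference by blast
  define c where "c = f (p * M + r) - poly s (of_nat M)"
  have "f (p * m + r) = poly (s + [:c:]) (of_nat m)" if "m \<ge> M" for m
    using that
  proof (induction m rule: dec_induct)
    case (step m)
    have "p * Suc m + r = p * m + r + p" by simp
    then have "f (p * Suc m + r) = f (p * m + r) + poly q (of_nat m)"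
      using q[OF step.hyps(1)] by (simp only:)
    moreover have "poly s (of_nat (Suc m)) = poly s (of_nat m) + poly q (of_nat m)"
      using s[of "of_nat m"] by (simp add: algebra_simps)
    ultimately show ?case using step.IH by (simp del: of_nat_Suc mult_Suc_right)
  qed (simp add: c_def)
  then show "\<exists>q. \<forall>\<^sub>F m in sequentially. f (p * m + r) = poly q (of_nat m)"
    unfolding eventually_sequentially by blast
qed

text \<open>The step \<open>k\<close> and the period \<open>p\<close> of the difference may
  disagree. Telescoping \<open>p\<close> steps of length \<open>k\<close> yields the difference with
  step \<open>p * k\<close>, which is also a period, and the case of equal step and period
  applies.\<close>

lemma quasi_poly_antidifference:
  assumes "k > 0" "quasi_poly (\<lambda>n. f (n + k) - f n)"
  shows "quasi_poly f"
proof -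
  obtain p where p: "p > 0" "quasi_poly_mod p (\<lambda>n. f (n + k) - f n)"
    using assms(2) unfolding quasi_poly_def by blast
  have *: "quasi_poly_mod (p * k) (\<lambda>n. \<Sum>i<l. f (n + k * i + k) - f (n + k * i))" for l
  proof (induction l)
    case 0
    then show ?case by (auto simp: quasi_poly_mod_def intro!: exI[of _ 0])
  next
    case (Suc l)
    show ?case unfolding quasi_poly_mod_def
    proof
      fix r
      obtain q1 q2 where "\<forall>\<^sub>F m in sequentially. (\<Sum>i<l. f (p * k * m + r + k * i + k) -
          f (p * k * m + r + k * i)) = poly q1 (of_nat m)"
        "\<forall>\<^sub>F m in sequentially. f (p * k * m + (r + k * l) + k) - f (p * k * m + (r + k * l)) =
          poly q2 (of_nat m)"
        using Suc quasi_poly_mod_mult[OF p(2) assms(1)] unfolding quasi_poly_mod_def by blast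
      then have "\<forall>\<^sub>F m in sequentially. (\<Sum>i<Suc l. f (p * k * m + r + k * i + k) -
          f (p * k * m + r + k * i)) = poly (q1 + q2) (of_nat m)"
        by eventually_elim (simp add: add.assoc)
      then show "\<exists>q. \<forall>\<^sub>F m in sequentially. (\<Sum>i<Suc l. f (p * k * m + r + k * i + k) -
          f (p * k * m + r + k * i)) = poly q (of_nat m)" ..
    qed
  qed
  have "(\<Sum>i<p. f (n + k * i + k) - f (n + k * i)) = f (n + p * k) - f n" for n
    using sum_lessThan_telescope[of "\<lambda>i. f (n + k * i)" p] by (simp add: algebra_simps)
  then have "quasi_poly_mod (p * k) f"
    using quasi_poly_mod_antidifference[of "p * k" f] *[of p] by simp
  then show ?thesis using p(1) assms(1) unfolding quasi_poly_def by (metis nat_0_less_mult_iff)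
qed

text \<open>Up to quasi-polynomials, each unknown with delay \<open>k\<close> equals the next one.
  As the sequence \<open>B\<close> takes finitely many values, some value recurs; going from it back
  to itself gives an equation in a single unknown, solved by antidifferences.\<close>

lemma quasi_poly_cyclic_system:
  assumes k: "k > 0" and fin: "finite (range B)"
    and step: "\<And>i. quasi_poly (\<lambda>n. G (B i) (n + k) - G (B (Suc i)) n)"
  shows "quasi_poly (G (B 0))"
proof -
  have iter: "quasi_poly (\<lambda>n. G (B i) (n + k * j) - G (B (i + j)) n)" for i j
  proof (induction j)
    case (Suc j)
    have "quasi_poly (\<lambda>n. G (B i) (n + k + k * j) - G (B (i + j)) (n + k))"
      using quasi_poly_shift_iff[of "\<lambda>n. G (B i) (n + k * j) - G (B (i + j)) n" k] Suc by simp
    from quasi_poly_add[OF this step[of "i + j"]] show ?case by (simp add: algebra_simps)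
  qed (simp add: quasi_poly_zero)
  have "\<not> inj B" using fin finite_imageD infinite_UNIV_nat by blast
  then obtain x y where xy: "B x = B y" "x \<noteq> y" unfolding inj_def by blast
  obtain a b where ab: "B a = B b" "a < b"
    using that[of x y] that[of y x] xy by (cases x y rule: linorder_cases) simp_all
  have "quasi_poly (\<lambda>n. G (B a) (n + k * (b - a)) - G (B a) n)"
    using iter[of a "b - a"] ab by simp
  moreover have "k * (b - a) > 0" using k ab by simp
  ultimately have "quasi_poly (G (B a))" by (rule quasi_poly_antidifference[rotated])
  \<comment> \<open>From the recurring value \<open>B a\<close> the result travels back along the
    \<open>a\<close> steps that lead there from \<open>B 0\<close>.\<close>
  from quasi_poly_add[OF this iter[of 0 a]] have "quasi_poly (\<lambda>n. G (B 0) (n + k * a))" by simp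
  then show ?thesis by (simp only: quasi_poly_shift_iff[of "G (B 0)"])
qed

section \<open>Counting ordinals by their norm\<close>

lemma not_less_zero [simp]: "\<not> \<alpha> < (0 :: eps0)"
  by (simp add: eps0_zero_le leD)

lemma less_one_iff: "\<eta> < omega_pow 0 \<longleftrightarrow> \<eta> = 0"
  by (simp add: less_omega_pow_iff)

text \<open>\<open>omega_pow 0\<close> is the ordinal one, so \<open>e + omega_pow 0\<close> is the
  successor of \<open>e\<close>.\<close>

lemma less_plus_one_iff: "\<delta> < e + omega_pow 0 \<longleftrightarrow> \<delta> \<le> e"
  by (auto simp: less_plus_iff less_one_iff)

lemma eps0_exhaust:
  obtains bs where "Rep_eps0 \<beta> = CNF bs" "normal (CNF bs)"
  using Rep_eps0[of \<beta>] that by (metis cnf.exhaust mem_Collect_eq)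

lemma less_Rep_plus_one_iff:
  assumes "normal b"
  shows "b < Rep_eps0 (e + omega_pow 0) \<longleftrightarrow> b \<le> Rep_eps0 e"
  using less_plus_one_iff[of "Abs_eps0 b" e] assms
  by (simp add: less_eps0.rep_eq less_eq_eps0.rep_eq Abs_eps0_inverse)

text \<open>The hypothesis says that all exponents of \<open>\<eta>\<close> are at most
  \<open>e\<close>. Then the sum merely puts \<open>e\<close> in front of the list of exponents, and
  nothing is absorbed.\<close>

lemma ord_norm_omega_pow_plus:
  assumes "\<eta> < omega_pow (e + omega_pow 0)"
  shows "ord_norm (omega_pow e + \<eta>) = Suc (ord_norm e) + ord_norm \<eta>"
proof -
  obtain bs where bs: "Rep_eps0 \<eta> = CNF bs" "normal (CNF bs)" by (rule eps0_exhaust)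
  show ?thesis
  proof (cases bs)
    case (Cons b bs')
    have "b \<le> Rep_eps0 e"
      using assms bs Cons
      by (auto simp: less_eps0.rep_eq omega_pow.rep_eq less_Rep_plus_one_iff)
    then show ?thesis
      by (simp add: ord_norm.rep_eq plus_eps0.rep_eq omega_pow.rep_eq bs Cons)
  qed (simp add: ord_norm.rep_eq plus_eps0.rep_eq omega_pow.rep_eq bs)
qed

lemma CNF_tail_less: "sorted_wrt (\<ge>) (b # bs) \<Longrightarrow> CNF bs < CNF (b # bs)"
proof (induction bs arbitrary: b)
  case (Cons c cs)
  then have "CNF cs < CNF (c # cs)" "c \<le> b" by auto
  then show ?case by (auto simp: order.order_iff_strict)
qed simp

lemma eps0_leading_term:
  assumes "\<beta> \<noteq> 0"
  obtains e \<beta>' where "\<beta> = omega_pow e + \<beta>'" "\<beta>' < omega_pow (e + omega_pow 0)" "\<beta>' < \<beta>"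
proof -
  obtain bs where bs: "Rep_eps0 \<beta> = CNF bs" "normal (CNF bs)" by (rule eps0_exhaust)
  have "bs \<noteq> []" using assms bs by (auto simp: Rep_eps0_inject[symmetric] zero_eps0.rep_eq)
  then obtain b cs where [simp]: "bs = b # cs" by (cases bs) auto
  define e \<beta>' where "e = Abs_eps0 b" and "\<beta>' = Abs_eps0 (CNF cs)"
  have n: "normal b" "normal (CNF cs)" using bs by auto
  then have Rep: "Rep_eps0 e = b" "Rep_eps0 \<beta>' = CNF cs"
    by (simp_all add: e_def \<beta>'_def Abs_eps0_inverse del: normal.simps)
  show thesis
  proof (rule that)
    show "\<beta> = omega_pow e + \<beta>'"
      using bs by (cases cs) (auto simp: Rep_eps0_inject[symmetric] plus_eps0.rep_eq
          omega_pow.rep_eq Rep)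
    show "\<beta>' < omega_pow (e + omega_pow 0)"
      using bs by (cases cs) (auto simp: less_eps0.rep_eq omega_pow.rep_eq Rep less_Rep_plus_one_iff)
    show "\<beta>' < \<beta>"
      using CNF_tail_less[of b cs] bs by (simp add: less_eps0.rep_eq Rep)
  qed
qed

text \<open>Addition drops the terms whose exponent is below the leading exponent on the right.
  Splitting off \<open>omega_pow d\<close> from \<open>omega_pow e\<close> thus leaves the same
  bound, which closes the recurrence.\<close>

lemma omega_pow_absorb: "d < e \<Longrightarrow> omega_pow d + omega_pow e = omega_pow e"
  by (simp add: Rep_eps0_inject[symmetric] plus_eps0.rep_eq omega_pow.rep_eq less_eps0.rep_eq)

lemma omega_pow_less_iff: "omega_pow d < omega_pow e \<longleftrightarrow> d < e"
  by (simp add: less_eps0.rep_eq omega_pow.rep_eq)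

text \<open>The leading exponent of \<open>e\<close> is below one, so all exponents vanish and
  \<open>e\<close> is a sum of ones. Thus below \<open>omega_pow omega\<close> every non-zero
  leading exponent is a successor.\<close>

lemma less_omega_cases:
  assumes "e < omega"
  obtains "e = 0" | d where "e = d + omega_pow 0"
proof -
  obtain bs where bs: "Rep_eps0 e = CNF bs" "normal (CNF bs)" by (rule eps0_exhaust)
  show thesis
  proof (cases bs)
    case Nil
    then show thesis using bs that(1) by (simp add: Rep_eps0_inject[symmetric] zero_eps0.rep_eq)
  next
    case (Cons b cs)
    have zero: "c = CNF []" if "c \<le> b" for c
    proof -
      have "b < CNF [CNF []]"
        using assms bs Cons
        by (auto simp: omega_def less_eps0.rep_eq omega_pow.rep_eq zero_eps0.rep_eq)
      with that have "c < CNF [CNF []]" by simp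
      then show ?thesis by (cases c, rename_tac xs, case_tac xs) auto
    qed
    have "\<forall>c \<in> set (b # cs). c = CNF []" using bs Cons zero by auto
    then have "bs = replicate (Suc (length cs)) (CNF [])"
      using Cons by (intro replicate_eqI) auto
    then have bs': "bs = replicate (length cs) (CNF []) @ [CNF []]"
      by (simp add: replicate_append_same)
    have "e = sum_list (replicate (length cs) (omega_pow 0)) + omega_pow 0"
      by (simp add: Rep_eps0_inject[symmetric] plus_eps0.rep_eq Rep_omega_pow_mult omega_pow.rep_eq
          zero_eps0.rep_eq bs(1) takeWhile_replicate) (simp add: bs')
    then show thesis by (rule that(2))
  qed
qed

text \<open>Rational values permit the subtractions in the recurrences and keep the polynomials over
  the rationals. The set \<open>A\<close> is arbitrary so that residuals can take its place.\<close>

definition norm_count :: "eps0 \<Rightarrow> eps0 set \<Rightarrow> nat \<Rightarrow> rat" where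
  "norm_count \<beta> A n = of_nat (card {\<alpha>. \<alpha> < \<beta> \<and> \<alpha> \<in> A \<and> ord_norm \<alpha> = n})"

text \<open>An ordinal below the sum is either below \<open>\<gamma>\<close> or of the form
  \<open>\<gamma> + \<eta>\<close> with unique \<open>\<eta> < \<beta>\<close>. Only arguments
  \<open>n + c\<close> are treated; quasi-polynomials are insensitive to such shifts.\<close>

lemma norm_count_plus:
  assumes "\<And>\<eta>. \<eta> < \<beta> \<Longrightarrow> ord_norm (\<gamma> + \<eta>) = c + ord_norm \<eta>"
  shows "norm_count (\<gamma> + \<beta>) A (n + c) = norm_count \<gamma> A (n + c) + norm_count \<beta> (residual \<gamma> A) n"
proof -
  let ?S = "{\<eta>. \<eta> < \<beta> \<and> \<eta> \<in> residual \<gamma> A \<and> ord_norm \<eta> = n}"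
  let ?T = "{\<alpha>. \<alpha> < \<gamma> \<and> \<alpha> \<in> A \<and> ord_norm \<alpha> = n + c}"
  have fin: "finite ?S" "finite ?T" by (auto intro: finite_subset[OF _ finite_ord_norm])
  have "{\<alpha>. \<alpha> < \<gamma> + \<beta> \<and> \<alpha> \<in> A \<and> ord_norm \<alpha> = n + c} = ?T \<union> (+) \<gamma> ` ?S"
    using assms by (auto simp: less_plus_iff residual_def image_iff)
  moreover have "?T \<inter> (+) \<gamma> ` ?S = {}" using le_plus[of \<gamma>] by (auto dest: leD)
  moreover have "card ((+) \<gamma> ` ?S) = card ?S" by (rule card_image) (simp add: inj_on_def)
  ultimately show ?thesis using fin by (simp add: norm_count_def card_Un_disjoint)
qed

lemma finite_range_residual:
  assumes "finite (range (\<lambda>\<gamma>. residual \<gamma> A))"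
  shows "finite (range (\<lambda>\<gamma>. residual \<gamma> (residual \<delta> A)))"
  by (rule finite_subset[OF _ assms]) (auto simp: residual_residual)

text \<open>Induction on \<open>\<beta>\<close> for all \<open>A\<close> at once, because the
  recurrences pass from \<open>A\<close> to its residuals, which again have finitely many
  residuals.\<close>

theorem quasi_poly_norm_count:
  assumes "\<beta> < omega_pow omega" "finite (range (\<lambda>\<gamma>. residual \<gamma> A))"
  shows "quasi_poly (norm_count \<beta> A)"
  using assms
proof (induction \<beta> arbitrary: A rule: less_induct)
  case (less \<beta>)
  show ?case
  proof (cases "\<beta> = 0")
    case True
    then have "norm_count \<beta> A = (\<lambda>n. 0)" by (simp add: norm_count_def fun_eq_iff)
    then show ?thesis by (simp add: quasi_poly_zero)
  next
    case False
    then obtain e \<beta>' where \<beta>': "\<beta> = omega_pow e + \<beta>'" "\<beta>' < omega_pow (e + omega_pow 0)" "\<beta>' < \<beta>"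
      by (rule eps0_leading_term)
    have e: "e < omega"
      using less.prems(1) le_plus[of "omega_pow e" \<beta>'] \<beta>'(1) by (metis le_less_trans omega_pow_less_iff)
    show ?thesis
    proof (cases "\<beta>' = 0")
      case False
      then have "omega_pow e < \<beta>"
        using plus_strict_mono[of 0 \<beta>' "omega_pow e"] eps0_zero_le[of \<beta>'] \<beta>'(1)
        by (simp add: order.strict_iff_order)
      then have "quasi_poly (norm_count (omega_pow e) A)" "quasi_poly (norm_count \<beta>' (residual (omega_pow e) A))"
        using less \<beta>'(3) finite_range_residual by (meson less_trans)+
      then have "quasi_poly (\<lambda>n. norm_count (omega_pow e) A (n + Suc (ord_norm e)) +
          norm_count \<beta>' (residual (omega_pow e) A) n)"
        using quasi_poly_shift_iff[of "norm_count (omega_pow e) A" "Suc (ord_norm e)"]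
        by (intro quasi_poly_add) simp_all
      moreover have "norm_count \<beta> A (n + Suc (ord_norm e)) = 
          norm_count (omega_pow e) A (n + Suc (ord_norm e)) +
          norm_count \<beta>' (residual (omega_pow e) A) n" for n
        unfolding \<beta>'(1)
      proof (rule norm_count_plus)
        show "ord_norm (omega_pow e + \<eta>) = Suc (ord_norm e) + ord_norm \<eta>" if "\<eta> < \<beta>'" for \<eta>
          using ord_norm_omega_pow_plus[OF less_trans[OF that \<beta>'(2)]] .
      qed
      ultimately show ?thesis using quasi_poly_shift_iff[of "norm_count \<beta> A" "Suc (ord_norm e)"] by simp
    next
      case True
      then have \<beta>: "\<beta> = omega_pow e" using \<beta>'(1) by simp
      from e show ?thesis
      proof (cases rule: less_omega_cases)
        case 1
        \<comment> \<open>Here \<open>\<beta>\<close> is one, and its only element has norm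
          zero.\<close>
        have "norm_count \<beta> A (n + 1) = 0" for n
          by (auto simp: norm_count_def \<beta> 1 less_one_iff ord_norm.rep_eq zero_eps0.rep_eq)
        then show ?thesis using quasi_poly_shift_iff[of "norm_count \<beta> A" 1] by (simp add: quasi_poly_zero)
      next
        case (2 d)
        then have d: "d < e" by (simp add: less_plus_one_iff)
        \<comment> \<open>\<open>B i\<close> is the residual of \<open>A\<close> after
          \<open>i\<close> copies of \<open>omega_pow d\<close>. All these are residuals of
          \<open>A\<close>, hence finite in number.\<close>
        define B where "B i = (residual (omega_pow d) ^^ i) A" for i
        have B: "B i \<in> range (\<lambda>\<gamma>. residual \<gamma> A)" for i
        proof (induction i)
          case 0
          then show ?case by (auto simp: B_def residual_def intro!: range_eqI[of _ _ 0])
        next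
          case (Suc i)
          then show ?case by (auto simp: B_def residual_residual)
        qed
        have "quasi_poly (norm_count \<beta> (B 0))"
        proof (rule quasi_poly_cyclic_system)
          show "Suc (ord_norm d) > 0" by simp
          show "finite (range B)" using B less.prems(2) by (meson finite_subset image_subsetI)
          fix i
          have "finite (range (\<lambda>\<gamma>. residual \<gamma> (B i)))"
            using B[of i] less.prems(2) finite_range_residual by auto
          then have "quasi_poly (norm_count (omega_pow d) (B i))"
            using less.IH less.prems(1) d unfolding \<beta> by (metis less_trans omega_pow_less_iff)
          \<comment> \<open>By absorption \<open>omega_pow d + \<beta>\<close> is
            \<open>\<beta>\<close> itself, so both sides count below the same bound.\<close>
          moreover have "norm_count \<beta> (B i) (n + Suc (ord_norm d)) =
              norm_count (omega_pow d) (B i) (n + Suc (ord_norm d)) + norm_count \<beta> (B (Suc i)) n" for n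
            using norm_count_plus[of \<beta> "omega_pow d" "Suc (ord_norm d)" "B i" n]
              ord_norm_omega_pow_plus[of _ d] omega_pow_absorb[OF d]
            by (simp add: \<beta> 2 B_def)
          ultimately show "quasi_poly (\<lambda>n. norm_count \<beta> (B i) (n + Suc (ord_norm d)) - norm_count \<beta> (B (Suc i)) n)"
            by (simp only: add_diff_cancel_right' quasi_poly_shift_iff[of "norm_count (omega_pow d) (B i)"])
        qed
        then show ?thesis by (simp add: B_def)
      qed
    qed
  qed
qed

section \<open>Limits along residue classes\<close>

lemma poly_map_of_rat: "poly (map_poly of_rat q) (of_rat x) = (of_rat (poly q x) :: 'a :: field_char_0)"
  by (induction q) (simp_all add: map_poly_pCons of_rat_add of_rat_mult)

text \<open>The bounds on the values rule out that \<open>a\<close> has the larger degree. Otherwise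
  the limit is 0 or the quotient of the leading coefficients, which are rational.\<close>

lemma rat_poly_ratio_tendsto:
  assumes "\<forall>\<^sub>F m in sequentially. 0 \<le> poly a (of_nat m) \<and> poly a (of_nat m) \<le> poly b (of_nat m) \<and>
    0 < poly b (of_nat m :: rat)"
  shows "\<exists>L\<in>\<rat>. (\<lambda>m. of_rat (poly a (of_nat m) / poly b (of_nat m)) :: real) \<longlonglongrightarrow> L"
proof -
  define P where "P q = (map_poly of_rat q :: real poly)" for q
  have P: "of_rat (poly q (of_nat m)) = poly (P q) (real m)" for q m
    using poly_map_of_rat[of q "of_nat m", where 'a = real] by (simp add: P_def)
  have deg: "degree (P q) = degree q" for q by (simp add: P_def degree_map_poly)
  have lead: "lead_coeff (P q) = of_rat (lead_coeff q)" for q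
    by (simp add: deg) (simp add: P_def coeff_map_poly)
  have inf: "filterlim real at_infinity sequentially"
    using filterlim_real_sequentially at_top_le_at_infinity by (rule filterlim_mono) simp
  have "\<exists>m. 0 < poly b (of_nat m)"
    using eventually_happens[OF assms] by auto
  then have "b \<noteq> 0" by auto
  have ratio: "of_rat (poly a (of_nat m) / poly b (of_nat m)) = poly (P a) (real m) / poly (P b) (real m)" for m
    by (simp add: of_rat_divide P)
  consider "degree a < degree b" | "degree a = degree b" | "degree b < degree a" by linarith
  then show ?thesis
  proof cases
    case 1
    then have "(\<lambda>m. poly (P a) (real m) / poly (P b) (real m)) \<longlonglongrightarrow> 0"
      by (intro filterlim_compose[OF poly_divide_tendsto_0_at_infinity inf]) (simp add: deg)
    then show ?thesis unfolding ratio by (intro bexI[of _ 0]) auto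
  next
    case 2
    have lim: "(\<lambda>m. poly (P q) (real m) / real m ^ degree (P q)) \<longlonglongrightarrow> lead_coeff (P q)" for q
      by (rule filterlim_compose[OF poly_divide_tendsto_aux inf])
    have "(\<lambda>m. (poly (P a) (real m) / real m ^ degree (P a)) / (poly (P b) (real m) / real m ^ degree (P b)))
        \<longlonglongrightarrow> lead_coeff (P a) / lead_coeff (P b)"
      using \<open>b \<noteq> 0\<close> by (intro tendsto_divide lim) (simp add: lead)
    moreover have "\<forall>\<^sub>F m in sequentially.
        (poly (P a) (real m) / real m ^ degree (P a)) / (poly (P b) (real m) / real m ^ degree (P b)) =
        poly (P a) (real m) / poly (P b) (real m)"
      using eventually_gt_at_top[of 0] by eventually_elim (simp add: deg 2)
    ultimately have "(\<lambda>m. poly (P a) (real m) / poly (P b) (real m)) \<longlonglongrightarrow> lead_coeff (P a) / lead_coeff (P b)"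
      by (rule Lim_transform_eventually)
    then show ?thesis
      unfolding ratio lead by (intro bexI) auto
  next
    case 3
    \<comment> \<open>Unlike \<open>a\<close>, the polynomial \<open>a + b\<close> has positive values, and \<open>b / (a + b) \<ge> 1 / 2\<close>.\<close>
    then have "(\<lambda>m. poly (P b) (real m) / poly (P (a + b)) (real m)) \<longlonglongrightarrow> 0"
      by (intro filterlim_compose[OF poly_divide_tendsto_0_at_infinity inf])
        (simp add: deg degree_add_eq_left)
    then have "\<forall>\<^sub>F m in sequentially. poly (P b) (real m) / poly (P (a + b)) (real m) < 1 / 2"
      by (rule order_tendstoD) simp
    with assms have "\<forall>\<^sub>F m :: nat in sequentially. False"
    proof eventually_elim
      case (elim m)
      then have "poly b (of_nat m) / poly (a + b) (of_nat m) \<ge> 1 / 2"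
        by (simp add: field_simps)
      moreover have "of_rat (poly b (of_nat m) / poly (a + b) (of_nat m)) < (of_rat (1 / 2) :: real)"
        unfolding of_rat_divide P using elim by simp
      ultimately show False by (simp only: of_rat_less)
    qed
    then show ?thesis by simp
  qed
qed

section \<open>Cesaro means\<close>

lemma cesaro_null:
  fixes v :: "nat \<Rightarrow> real"
  assumes "v \<longlonglongrightarrow> 0"
  shows "(\<lambda>n. 1 / real n * (\<Sum>i = 0..n. v i)) \<longlonglongrightarrow> 0"
proof (rule LIMSEQ_I)
  fix e :: real assume e: "e > 0"
  \<comment> \<open>The mean has \<open>n + 1\<close> summands but divisor \<open>n\<close>; for
    \<open>n \<ge> 1\<close> the bound \<open>e / 4\<close> on the late terms contributes at most
    \<open>e / 2\<close>, and the early terms with total \<open>C\<close> get the other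
    half.\<close>
  then obtain N where N: "\<And>i. i \<ge> N \<Longrightarrow> \<bar>v i\<bar> < e / 4"
    using LIMSEQ_D[OF assms, of "e / 4"] by auto
  define C where "C = (\<Sum>i<N. \<bar>v i\<bar>)"
  obtain M :: nat where M: "real M > 2 * C / e" using reals_Archimedean2 by blast
  have "norm (1 / real n * (\<Sum>i = 0..n. v i) - 0) < e" if n: "n \<ge> max M 1" for n
  proof -
    have "(\<Sum>i\<le>n. \<bar>v i\<bar>) \<le> (\<Sum>i\<le>n. (if i < N then \<bar>v i\<bar> else 0) + e / 4)"
      using N e by (intro sum_mono) (auto simp: not_less intro: less_imp_le)
    also have "\<dots> = (\<Sum>i\<in>{..n} \<inter> {..<N}. \<bar>v i\<bar>) + (real n + 1) * (e / 4)"
      by (simp add: sum.distrib sum.If_cases lessThan_def algebra_simps)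
    also have "(\<Sum>i\<in>{..n} \<inter> {..<N}. \<bar>v i\<bar>) \<le> C"
      unfolding C_def by (intro sum_mono2) auto
    finally have "(\<Sum>i\<le>n. \<bar>v i\<bar>) \<le> C + (real n + 1) * (e / 4)" by simp
    moreover have "(real n + 1) * (e / 4) \<le> real n * (e / 2)"
      using mult_right_mono[of 1 "real n" "e / 4"] n e by (simp add: algebra_simps)
    moreover have "C < real n * (e / 2)"
    proof -
      have "2 * C / e < real n" using M n by simp
      then show ?thesis using e by (simp add: field_simps)
    qed
    moreover have "\<bar>\<Sum>i = 0..n. v i\<bar> \<le> (\<Sum>i\<le>n. \<bar>v i\<bar>)"
      by (simp add: atMost_atLeast0)
    ultimately have "\<bar>\<Sum>i = 0..n. v i\<bar> < real n * (e / 2) + real n * (e / 2)" by linarith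
    then have "\<bar>\<Sum>i = 0..n. v i\<bar> < real n * e" by (simp only: field_sum_of_halves flip: distrib_left)
    then show ?thesis using n by (simp add: abs_mult field_simps)
  qed
  then show "\<exists>no. \<forall>n\<ge>no. norm (1 / real n * (\<Sum>i = 0..n. v i) - 0) < e" by blast
qed

text \<open>Full periods sum to zero, so the argument can be lowered by \<open>p\<close> until less
  than one period remains.\<close>

lemma sum_periodic_bounded:
  fixes f :: "nat \<Rightarrow> real"
  assumes "\<And>n. f (n + p) = f n" "(\<Sum>i<p. f i) = 0" "p > 0"
  shows "\<bar>\<Sum>i<n. f i\<bar> \<le> (\<Sum>i<p. \<bar>f i\<bar>)"
proof (induction n rule: less_induct)
  case (less n)
  show ?case
  proof (cases "n < p")
    case True
    have "\<bar>\<Sum>i<n. f i\<bar> \<le> (\<Sum>i<n. \<bar>f i\<bar>)" by (rule sum_abs)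
    also have "\<dots> \<le> (\<Sum>i<p. \<bar>f i\<bar>)" using True by (intro sum_mono2) auto
    finally show ?thesis .
  next
    case False
    have "(\<Sum>i<n. f i) = (\<Sum>i<p. f i) + (\<Sum>i\<in>{p..<n}. f i)"
      using sum.atLeastLessThan_concat[of 0 p n f] False by (simp add: lessThan_atLeast0)
    also have "(\<Sum>i\<in>{p..<n}. f i) = (\<Sum>i<n - p. f i)"
      using sum.shift_bounds_nat_ivl[of f 0 p "n - p"] False assms(1)
      by (simp add: lessThan_atLeast0)
    finally show ?thesis using less[of "n - p"] assms False by simp
  qed
qed

text \<open>\<open>u\<close> is split into a null sequence \<open>v\<close>, a periodic sequence
  \<open>w\<close> of mean zero with bounded partial sums, and the constant
  \<open>a\<close>.\<close>

lemma cesaro_residue_classes: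
  fixes u :: "nat \<Rightarrow> real"
  assumes p: "p > 0" and L: "\<And>r. (\<lambda>m. u (p * m + r)) \<longlonglongrightarrow> L r"
  shows "(\<lambda>n. 1 / real n * (\<Sum>i = 0..n. u i)) \<longlonglongrightarrow> (\<Sum>r<p. L r) / real p"
proof -
  define a where "a = (\<Sum>r<p. L r) / real p"
  define v where "v n = u n - L (n mod p)" for n
  define w where "w n = L (n mod p) - a" for n
  have "v \<longlonglongrightarrow> 0"
  proof (rule tendstoI)
    fix e :: real assume "e > 0"
    then have "\<forall>r\<in>{..<p}. \<forall>\<^sub>F m in sequentially. dist (u (p * m + r)) (L r) < e"
      using L tendstoD by blast
    then have "\<forall>\<^sub>F m in sequentially. \<forall>r\<in>{..<p}. dist (u (p * m + r)) (L r) < e"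
      by (simp add: eventually_ball_finite)
    \<comment> \<open>There are finitely many residues, so one threshold serves all of them, and
      \<open>n div p\<close> tends to infinity with \<open>n\<close>.\<close>
    then have "\<forall>\<^sub>F n in sequentially. \<forall>r\<in>{..<p}. dist (u (p * (n div p) + r)) (L r) < e"
      by (rule eventually_compose_filterlim) (rule filterlim_at_top_div_const_nat[OF p])
    then show "\<forall>\<^sub>F n in sequentially. dist (v n) 0 < e"
    proof eventually_elim
      case (elim n)
      from elim[rule_format, of "n mod p"] p show ?case by (simp add: v_def dist_real_def)
    qed
  qed
  then have 1: "(\<lambda>n. 1 / real n * (\<Sum>i = 0..n. v i)) \<longlonglongrightarrow> 0" by (rule cesaro_null)
  have "\<bar>\<Sum>i<Suc n. w i\<bar> \<le> (\<Sum>i<p. \<bar>w i\<bar>)" for n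
    using p by (intro sum_periodic_bounded) (auto simp: w_def sum_subtractf a_def)
  then have bound: "\<bar>\<Sum>i = 0..n. w i\<bar> \<le> (\<Sum>i<p. \<bar>w i\<bar>)" for n
    by (simp only: lessThan_Suc_atMost atMost_atLeast0)
  have 2: "(\<lambda>n. 1 / real n * (\<Sum>i = 0..n. w i)) \<longlonglongrightarrow> 0"
  proof (rule tendsto_0_le[OF lim_1_over_n])
    show "\<forall>\<^sub>F n in sequentially. norm (1 / real n * (\<Sum>i = 0..n. w i)) \<le>
        norm (1 / real n) * (\<Sum>i<p. \<bar>w i\<bar>)"
      using bound by (intro always_eventually) (auto simp: abs_mult intro!: divide_right_mono)
  qed
  \<comment> \<open>The sum from 0 to \<open>n\<close> has \<open>n + 1\<close> terms, so a constant
    \<open>a\<close> has mean \<open>a + a / n\<close>.\<close>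
  have "(\<lambda>n. 1 / real n * a + a) \<longlonglongrightarrow> 0 * a + a"
    by (intro tendsto_intros lim_1_over_n)
  moreover have "\<forall>\<^sub>F n in sequentially. 1 / real n * a + a = 1 / real n * (\<Sum>i = 0..n. a)"
    using eventually_gt_at_top[of 0] by eventually_elim (simp add: field_simps)
  ultimately have 3: "(\<lambda>n. 1 / real n * (\<Sum>i = 0..n. a)) \<longlonglongrightarrow> 0 * a + a"
    by (rule Lim_transform_eventually)
  have "u i = v i + w i + a" for i by (simp add: v_def w_def)
  then show ?thesis
    using tendsto_add[OF tendsto_add[OF 1 2] 3] unfolding a_def[symmetric]
    by (simp only: sum.distrib distrib_left add_0 mult_zero_left)
qed

section \<open>The limit law\<close>

text \<open>The denominator is the count for \<open>UNIV\<close>, so one theorem handles both parts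
  of the fraction.\<close>

lemma delta_eq_norm_count:
  "delta \<phi> \<beta> n = of_rat (norm_count \<beta> {\<alpha>. \<alpha> \<Turnstile> \<phi>} n / norm_count \<beta> UNIV n)"
  by (simp add: delta_def norm_count_def of_rat_divide)

lemma norm_count_le_UNIV: "norm_count \<beta> A n \<le> norm_count \<beta> UNIV n"
  unfolding norm_count_def of_nat_le_iff
  by (rule card_mono) (auto intro: finite_subset[OF _ finite_ord_norm[of n]])

lemma norm_count_UNIV_pos:
  assumes "omega \<le> \<beta>"
  shows "norm_count \<beta> UNIV n > 0"
proof -
  obtain \<alpha> where "\<alpha> < omega" "ord_norm \<alpha> = n" using ex_ord_norm by blast
  then have "\<alpha> \<in> {\<alpha>. \<alpha> < \<beta> \<and> \<alpha> \<in> UNIV \<and> ord_norm \<alpha> = n}" using assms by auto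
  moreover have "finite {\<alpha>. \<alpha> < \<beta> \<and> \<alpha> \<in> UNIV \<and> ord_norm \<alpha> = n}"
    by (rule finite_subset[OF _ finite_ord_norm[of n]]) auto
  ultimately show ?thesis unfolding norm_count_def of_nat_0_less_iff card_gt_0_iff by blast
qed

lemma norm_count_ratio_tendsto:
  assumes "omega \<le> \<beta>" "quasi_poly_mod p (norm_count \<beta> A)" "quasi_poly_mod p (norm_count \<beta> UNIV)"
  shows "\<exists>L\<in>\<rat>. (\<lambda>m. of_rat (norm_count \<beta> A (p * m + r) / norm_count \<beta> UNIV (p * m + r)) :: real)
    \<longlonglongrightarrow> L"
proof -
  obtain a b where ab: "\<forall>\<^sub>F m in sequentially. norm_count \<beta> A (p * m + r) = poly a (of_nat m)"
    "\<forall>\<^sub>F m in sequentially. norm_count \<beta> UNIV (p * m + r) = poly b (of_nat m)"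
    using assms(2,3) unfolding quasi_poly_mod_def by blast
  then have "\<forall>\<^sub>F m in sequentially. 0 \<le> poly a (of_nat m) \<and>
      poly a (of_nat m) \<le> poly b (of_nat m) \<and> 0 < poly b (of_nat m)"
  proof eventually_elim
    case (elim m)
    have "0 \<le> norm_count \<beta> A (p * m + r)" by (simp add: norm_count_def)
    then show ?case
      using norm_count_le_UNIV[of \<beta> A "p * m + r"] norm_count_UNIV_pos[OF assms(1), of "p * m + r"]
      unfolding elim by blast
  qed
  then obtain L where L: "L \<in> \<rat>" 
    "(\<lambda>m. of_rat (poly a (of_nat m) / poly b (of_nat m)) :: real) \<longlonglongrightarrow> L"
    using rat_poly_ratio_tendsto by blast
  have "\<forall>\<^sub>F m in sequentially. (of_rat (poly a (of_nat m) / poly b (of_nat m)) :: real) =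
      of_rat (norm_count \<beta> A (p * m + r) / norm_count \<beta> UNIV (p * m + r))"
    using ab by eventually_elim simp
  from Lim_transform_eventually[OF L(2) this] L(1) show ?thesis by (rule bexI)
qed

theorem mainTheorem1:
  fixes \<beta> :: eps0
  assumes "omega \<le> \<beta>" and "\<beta> < omega_pow omega"
  shows "\<forall>\<phi>. sentence \<phi> \<longrightarrow>
    (\<exists>L \<in> \<rat>. (\<lambda>n. 1 / real n * (\<Sum>i = 0..n. delta \<phi> \<beta> i)) \<longlonglongrightarrow> L)"
proof (intro allI impI)
  fix \<phi>
  let ?A = "{\<alpha>. \<alpha> \<Turnstile> \<phi>}"
  \<comment> \<open>Every residual of \<open>UNIV\<close> is \<open>UNIV\<close>.\<close>
  have "finite (range (\<lambda>\<gamma>. residual \<gamma> UNIV))" by (simp add: residual_def)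
  then have "quasi_poly (norm_count \<beta> ?A)" "quasi_poly (norm_count \<beta> UNIV)"
    using quasi_poly_norm_count[OF assms(2)] finite_residuals_satisfies by blast+
  then obtain p where p: "p > 0"
    "quasi_poly_mod p (norm_count \<beta> ?A)" "quasi_poly_mod p (norm_count \<beta> UNIV)"
    by (rule quasi_poly_common_period)
  have "\<forall>r. \<exists>L\<in>\<rat>. (\<lambda>m. delta \<phi> \<beta> (p * m + r)) \<longlonglongrightarrow> L"
    unfolding delta_eq_norm_count by (intro allI norm_count_ratio_tendsto assms(1) p(2,3))
  from choice[OF this[unfolded Bex_def]]
  obtain L where L: "\<And>r. L r \<in> \<rat>" "\<And>r. (\<lambda>m. delta \<phi> \<beta> (p * m + r)) \<longlonglongrightarrow> L r" by blast
  have "(\<Sum>r<p. L r) / real p \<in> \<rat>" by (intro Rats_divide Rats_sum L Rats_of_nat)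
  from cesaro_residue_classes[OF p(1) L(2)] this
  show "\<exists>L \<in> \<rat>. (\<lambda>n. 1 / real n * (\<Sum>i = 0..n. delta \<phi> \<beta> i)) \<longlonglongrightarrow> L"
    by (rule bexI)
qed

end
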